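(* Assume the Continuum Hypothesis. There is a crowded, $0$-dimensional Hausdorff space $X$ of cardinality $\omega_1$ having three dense subspaces $Z_1$, $Z_2$ and $Z_3$ such that: (1) every non-empty regular closed subset of $Z_1$ is DRS$_\omega$ but not DRC; (2) every non-empty regular closed subset of $Z_2$ is DRS$_\omega$ and DRC, but not DRS; (3) every non-empty regular closed subset of $Z_3$ is DRC$_\omega$, but neither DRC nor DRS$_\omega$.
   Context: A space is crowded if it has no isolated points. A space is $0$-dimensional if it has a base of clopen sets. A regular closed subset of a space is a set equal to the closure of its interior; regular closed subsets of $Z_i$ are taken in the space $Z_i$ and are regarded as topological spaces with the subspace topology. For a space $Y$ and a sequence $\vec a=\langle a_n:n\in\omega\rangle$ of points of $Y$, a point $x\in Y$ is an accumulation point of $\vec a$ if $\{n\in\omega: a_n\in U\}$ is infinite for each open $U\ni x$. A subspace $S\subset Y$ is relatively countably compact (in $Y$) if every sequence of points of $S$ has an accumulation point in $Y$. A subspace $S\subset Y$ is relatively sequentially compact (in $Y$) if every sequence of points of $S$ contains a subsequence converging to some point of $Y$. $Y$ is DRC if it contains a dense, relatively countably compact subset. $Y$ is DRS if it contains a dense, relatively sequentially compact subset. $Y$ is DRC$_\omega$ if there is a sequence $\langle D_n:n\in\omega\rangle$ of dense subsets of $Y$ such that every sequence $\langle d_n:n\in\omega\rangle$ with $d_n\in D_n$ for all $n$ has an accumulation point in $Y$. $Y$ is DRS$_\omega$ if there is a sequence $\langle D_n:n\in\omega\rangle$ of dense subsets of $Y$ such that every sequence $\langle d_n:n\in\omega\rangle$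 with $d_n\in D_n$ for all $n$ contains a subsequence converging to a point of $Y$. *)

theory Defs
  imports "HOL-Analysis.Analysis"
begin

context includes cardinal_syntax
begin

definition Continuum_Hypothesis :: bool
  where "Continuum_Hypothesis \<longleftrightarrow> ctwo ^c natLeq =o cardSuc natLeq"

definition has_cardinality_omega1 :: "'a set \<Rightarrow> bool"
  where "has_cardinality_omega1 S \<longleftrightarrow> |S| =o cardSuc natLeq"

end

definition crowded_space :: "'a topology \<Rightarrow> bool"
  where "crowded_space X \<longleftrightarrow> (\<forall>x \<in> topspace X. \<not> openin X {x})"

definition zero_dimensional_space :: "'a topology \<Rightarrow> bool"
  where "zero_dimensional_space X \<longleftrightarrow>
    (\<exists>\<B>. (\<forall>V \<in> \<B>. openin X V \<and> closedin X V) \<and>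
         (\<forall>U x. openin X U \<and> x \<in> U \<longrightarrow> (\<exists>V \<in> \<B>. x \<in> V \<and> V \<subseteq> U)))"

definition dense_subset_of :: "'a set \<Rightarrow> 'a topology \<Rightarrow> bool"
  where "dense_subset_of D X \<longleftrightarrow> D \<subseteq> topspace X \<and> X closure_of D = topspace X"

definition regular_closed_in :: "'a topology \<Rightarrow> 'a set \<Rightarrow> bool"
  where "regular_closed_in X K \<longleftrightarrow> X closure_of (X interior_of K) = K"

definition accumulation_point_of_seq :: "'a topology \<Rightarrow> (nat \<Rightarrow> 'a) \<Rightarrow> 'a \<Rightarrow> bool"
  where "accumulation_point_of_seq Y a x \<longleftrightarrow>
    x \<in> topspace Y \<and> (\<forall>U. openin Y U \<and> x \<in> U \<longrightarrow> infinite {n. a n \<in> U})"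

definition has_convergent_subsequence :: "'a topology \<Rightarrow> (nat \<Rightarrow> 'a) \<Rightarrow> bool"
  where "has_convergent_subsequence Y a \<longleftrightarrow>
    (\<exists>(r :: nat \<Rightarrow> nat) x. strict_mono r \<and> limitin Y (a \<circ> r) x sequentially)"

definition relatively_countably_compact :: "'a topology \<Rightarrow> 'a set \<Rightarrow> bool"
  where "relatively_countably_compact Y S \<longleftrightarrow>
    S \<subseteq> topspace Y \<and>
    (\<forall>a :: nat \<Rightarrow> 'a. (\<forall>n. a n \<in> S) \<longrightarrow> (\<exists>x. accumulation_point_of_seq Y a x))"

definition relatively_sequentially_compact :: "'a topology \<Rightarrow> 'a set \<Rightarrow> bool"
  where "relatively_sequentially_compact Y S \<longleftrightarrow>
    S \<subseteq> topspace Y \<and>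
    (\<forall>a :: nat \<Rightarrow> 'a. (\<forall>n. a n \<in> S) \<longrightarrow> has_convergent_subsequence Y a)"

definition DRC :: "'a topology \<Rightarrow> bool"
  where "DRC Y \<longleftrightarrow> (\<exists>D. dense_subset_of D Y \<and> relatively_countably_compact Y D)"

definition DRS :: "'a topology \<Rightarrow> bool"
  where "DRS Y \<longleftrightarrow> (\<exists>D. dense_subset_of D Y \<and> relatively_sequentially_compact Y D)"

definition DRC_omega :: "'a topology \<Rightarrow> bool"
  where "DRC_omega Y \<longleftrightarrow>
    (\<exists>D :: nat \<Rightarrow> 'a set. (\<forall>n. dense_subset_of (D n) Y) \<and>
      (\<forall>d. (\<forall>n. d n \<in> D n) \<longrightarrow> (\<exists>x. accumulation_point_of_seq Y d x)))"

definition DRS_omega :: "'a topology \<Rightarrow> bool"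
  where "DRS_omega Y \<longleftrightarrow>
    (\<exists>D :: nat \<Rightarrow> 'a set. (\<forall>n. dense_subset_of (D n) Y) \<and>
      (\<forall>d. (\<forall>n. d n \<in> D n) \<longrightarrow> has_convergent_subsequence Y d))"

end

theory Submission
  imports Defs "HOL-Library.Countable_Set_Type"
begin

text \<open>
  All three spaces are dense subspaces of a set of points of the power \<open>3\<^bsup>\<omega>\<^sub>1\<^esup>\<close>, constructed by a recursion of
  length \<open>\<omega>\<^sub>1\<close> in which stage \<open>\<alpha>\<close> adds the \<open>\<alpha>\<close>-th point and the \<open>\<alpha>\<close>-th coordinate.
  Each space is a union of countably many dense layers \<open>D\<^sub>m\<close>, and an infinite countable set
  has an infinite subset that lies in one layer or is transversal, that is, meets each layer in
  a finite set. Such a subset is treated according to its kind: it contains a sequence that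
  converges (transversal, \<open>Z\<^sub>1\<close> and \<open>Z\<^sub>2\<close>), or it has a cluster point but does not converge
  (transversal, \<open>Z\<^sub>3\<close>; in one layer, \<open>Z\<^sub>2\<close>), or it is closed and discrete (in one layer, \<open>Z\<^sub>1\<close> and \<open>Z\<^sub>3\<close>).
  The layers then witness the positive properties. For the negative ones, countable sets are
  nowhere dense, so a dense set has an infinite intersection with some layer.

  A limit point \<open>x\<close> comes with a filter \<open>F x\<close> along which every later coordinate has to converge to its
  value at \<open>x\<close>. The filter is either the cofinite filter of a sequence or the image of a P-point.
  In both cases countably many of these filters have pairwise disjoint members, and this is what
  leaves enough freedom in the choice of the next coordinate.
\<close>

section \<open>The type of countable ordinals\<close>

unbundle cardinal_syntax

text \<open>A type in class \<open>wellorder\<close> gives transfinite recursion in the form of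
  \<open>dependent_wellorder_choice\<close>. The successor cardinal is an initial ordinal, so all
  proper initial segments are countable.\<close>

typedef omega1 = "Field (cardSuc natLeq)"
proof -
  have "infinite (Field (cardSuc natLeq))"
    by (simp add: cardSuc_finite[OF natLeq_Card_order] Field_natLeq)
  then show ?thesis
    by (metis finite.emptyI ex_in_conv)
qed

instantiation omega1 :: wellorder
begin

definition less_eq_omega1 :: "omega1 \<Rightarrow> omega1 \<Rightarrow> bool"
  where "a \<le> b \<longleftrightarrow> (Rep_omega1 a, Rep_omega1 b) \<in> cardSuc natLeq"

definition less_omega1 :: "omega1 \<Rightarrow> omega1 \<Rightarrow> bool"
  where "a < b \<longleftrightarrow> a \<le> b \<and> a \<noteq> (b :: omega1)"

instance
proof
  let ?r = "cardSuc natLeq"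
  have wo: "Well_order ?r"
    using cardSuc_Card_order[OF natLeq_Card_order] by (simp add: card_order_on_def)
  then have rfl: "refl_on (Field ?r) ?r" and trn: "trans ?r" and asy: "antisym ?r"
    and tot: "total_on (Field ?r) ?r" and wf: "wf (?r - Id)"
    by (simp_all add: well_order_on_def linear_order_on_def partial_order_on_def preorder_on_def)
  note inj = Rep_omega1_inject
  fix x y z :: omega1
  have anti: "x \<le> y \<Longrightarrow> y \<le> x \<Longrightarrow> x = y" for x y :: omega1
    unfolding less_eq_omega1_def inj[symmetric, of x] by (rule antisymD[OF asy])
  then show "x \<le> y \<Longrightarrow> y \<le> x \<Longrightarrow> x = y" .
  show refl: "x \<le> x" for x :: omega1
    using refl_onD[OF rfl Rep_omega1] unfolding less_eq_omega1_def .
  show "x < y \<longleftrightarrow> x \<le> y \<and> \<not> y \<le> x"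
    unfolding less_omega1_def using anti[of x y] refl[of x] by auto
  show "x \<le> y \<Longrightarrow> y \<le> z \<Longrightarrow> x \<le> z"
    unfolding less_eq_omega1_def by (rule transD[OF trn])
  show "x \<le> y \<or> y \<le> x"
    using tot Rep_omega1[of x] Rep_omega1[of y] refl_onD[OF rfl Rep_omega1]
    unfolding less_eq_omega1_def total_on_def by (cases "x = y") (auto simp: inj)
  have wf': "wf {(a, b :: omega1). a < b}"
  proof (rule wf_subset[OF wf_inv_image[OF wf, of Rep_omega1]])
    show "{(a, b). a < b} \<subseteq> inv_image (?r - Id) Rep_omega1"
      by (auto simp: less_omega1_def less_eq_omega1_def inj)
  qed
  show "P x" if "\<And>x. (\<And>y. y < x \<Longrightarrow> P y) \<Longrightarrow> P x" for P and x :: omega1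
    by (rule wf_induct_rule[OF wf']) (use that in auto)
qed

end

lemma countable_lessThan_omega1: "countable {..<a :: omega1}"
proof -
  let ?r = "cardSuc natLeq"
  have co: "Card_order ?r"
    by (rule cardSuc_Card_order[OF natLeq_Card_order])
  have "|underS ?r (Rep_omega1 a)| <o ?r"
    by (rule card_of_underS[OF co Rep_omega1])
  then have "|underS ?r (Rep_omega1 a)| \<le>o natLeq"
    using cardSuc_ordLeq_ordLess[OF natLeq_Card_order card_of_Card_order] by blast
  then have "countable (underS ?r (Rep_omega1 a))"
    by (simp add: countable_card_le_natLeq)
  moreover have "Rep_omega1 ` {..<a} \<subseteq> underS ?r (Rep_omega1 a)"
    by (auto simp: underS_def less_omega1_def less_eq_omega1_def Rep_omega1_inject)
  ultimately have "countable (Rep_omega1 ` {..<a})"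
    by (rule countable_subset[rotated])
  then show ?thesis
    by (rule countable_image_inj_on) (simp add: inj_on_def Rep_omega1_inject)
qed

lemma countable_atMost_omega1: "countable {..a :: omega1}"
  using countable_lessThan_omega1[of a] by (simp add: ivl_disj_un(2)[symmetric])

lemma card_omega1: "|UNIV :: omega1 set| =o cardSuc natLeq"
proof -
  have "bij_betw Rep_omega1 UNIV (Field (cardSuc natLeq))"
    by (metis bij_betw_def Rep_omega1_inject injI type_definition.Rep_range type_definition_omega1)
  then have "|UNIV :: omega1 set| =o |Field (cardSuc natLeq)|"
    using card_of_ordIso by blast
  then show ?thesis
    using card_of_Field_ordIso[OF cardSuc_Card_order[OF natLeq_Card_order]] ordIso_transitive by blast
qed

lemma uncountable_omega1: "uncountable (UNIV :: omega1 set)"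
proof
  assume "countable (UNIV :: omega1 set)"
  then have "|UNIV :: omega1 set| \<le>o natLeq"
    by (simp add: countable_card_le_natLeq)
  then have "cardSuc natLeq \<le>o natLeq"
    using card_omega1 ordIso_symmetric ordIso_ordLeq_trans by blast
  then show False
    using cardSuc_greater[OF natLeq_Card_order] not_ordLess_ordLeq by blast
qed

text \<open>Otherwise \<open>S\<close> would be covered by countably many countable initial
  segments.\<close>

lemma uncountable_above_countable_omega1:
  assumes "countable (D :: omega1 set)" and "uncountable S"
  shows "\<exists>\<alpha>\<in>S. \<forall>x\<in>D. x < \<alpha>"
proof -
  have "countable (\<Union>x\<in>D. {..x})"
    using assms(1) countable_atMost_omega1 by blast
  then have "\<not> S \<subseteq> (\<Union>x\<in>D. {..x})"
    using assms(2) countable_subset by metis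
  then obtain \<alpha> where "\<alpha> \<in> S" "\<alpha> \<notin> (\<Union>x\<in>D. {..x})"
    by (meson subsetI)
  then show ?thesis
    by (auto simp: not_le)
qed

section \<open>Coding of tasks under the continuum hypothesis\<close>

lemma card_nat_set_CH:
  assumes Continuum_Hypothesis
  shows "|UNIV :: nat set set| =o cardSuc natLeq"
proof -
  have "|UNIV :: nat set set| =o ctwo ^c |UNIV :: nat set|"
    using card_of_Pow_Func[of "UNIV :: nat set"] by (simp only: cexp_def ctwo_def Field_card_of Pow_UNIV)
  also have "ctwo ^c |UNIV :: nat set| =o ctwo ^c natLeq"
    by (rule cexp_cong2[OF card_of_nat Card_order_ctwo card_of_Card_order])
  also have "ctwo ^c natLeq =o cardSuc natLeq"
    using assms by (simp add: Continuum_Hypothesis_def)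
  finally show ?thesis .
qed

lemma bij_omega1_nat_set_CH:
  assumes Continuum_Hypothesis
  obtains \<iota> :: "omega1 \<Rightarrow> nat set" where "bij \<iota>"
proof -
  have "|UNIV :: omega1 set| =o |UNIV :: nat set set|"
    using ordIso_transitive[OF card_omega1 ordIso_symmetric[OF card_nat_set_CH[OF assms]]] .
  then show thesis
    using that unfolding card_of_ordIso[symmetric] by blast
qed

text \<open>A pairing function packs countably many sets of numbers into one. Under the continuum
  hypothesis, sequences of countable ordinals can thus be coded by countable ordinals.\<close>

lemma inj_sequences_nat_set:
  fixes \<iota> :: "'a \<Rightarrow> nat set"
  assumes "inj \<iota>"
  shows "inj (\<lambda>f :: nat \<Rightarrow> 'a. {prod_encode (n, k) | n k. k \<in> \<iota> (f n)})"
proof (rule injI, rule ext)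
  fix f g :: "nat \<Rightarrow> 'a" and n
  assume "{prod_encode (n, k) | n k. k \<in> \<iota> (f n)} = {prod_encode (n, k) | n k. k \<in> \<iota> (g n)}"
  then have "k \<in> \<iota> (f n) \<longleftrightarrow> k \<in> \<iota> (g n)" for k
    by (simp add: set_eq_iff) (metis prod.inject prod_decode_inverse prod_encode_inverse)
  then show "f n = g n"
    using assms by (meson injD set_eqI)
qed

text \<open>One sequence codes a point \<open>e 0\<close> together with a countable set avoiding it.
  Removing \<open>e 0\<close> from the later values allows that set to be empty.\<close>

definition tail :: "(nat \<Rightarrow> 'a) \<Rightarrow> 'a set"
  where "tail e = range (e \<circ> Suc) - {e 0}"

lemma tail_exists:
  assumes "countable P" and "y \<notin> P"
  obtains e :: "nat \<Rightarrow> 'a" where "e 0 = y" "tail e = P" "range e = insert y P"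
proof -
  define e where "e n = (case n of 0 \<Rightarrow> y | Suc k \<Rightarrow> from_nat_into (insert y P) k)" for n
  have "range (e \<circ> Suc) = insert y P"
    using range_from_nat_into[of "insert y P"] assms(1) by (simp add: e_def comp_def)
  moreover have "range e = insert (e 0) (range (e \<circ> Suc))"
    by (auto simp: image_iff) (metis not0_implies_Suc)
  moreover have "e 0 = y"
    by (simp add: e_def)
  ultimately show thesis
    using that[of e] assms(2) by (auto simp: tail_def)
qed

text \<open>By the continuum hypothesis all tasks are coded by countable ordinals, and every code carries a
  dummy parameter ranging over \<open>\<omega>\<^sub>1\<close>, so that each task recurs cofinally often.\<close>

lemma omega1_tasks_CH:
  assumes Continuum_Hypothesis
  obtains Q :: "omega1 \<Rightarrow> omega1 \<Rightarrow> nat" and E :: "omega1 \<Rightarrow> nat \<Rightarrow> omega1"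
    and L :: "omega1 \<Rightarrow> nat \<times> nat"
  where "\<And>\<alpha> \<beta>. Q \<alpha> \<beta> < 3"
    and "\<And>e P q l D. countable P \<Longrightarrow> (\<And>\<beta>. q \<beta> < 3) \<Longrightarrow> countable D \<Longrightarrow>
      \<exists>\<alpha>. E \<alpha> = e \<and> (\<forall>\<beta>\<in>P. Q \<alpha> \<beta> = q \<beta>) \<and> L \<alpha> = l \<and> (\<forall>x\<in>D. x < \<alpha>)"
proof -
  obtain \<iota> :: "omega1 \<Rightarrow> nat set" where \<iota>: "bij \<iota>"
    using bij_omega1_nat_set_CH[OF assms] .
  define J where "J f = inv \<iota> {prod_encode (n, k) | n k. k \<in> \<iota> (f n)}" for f :: "nat \<Rightarrow> omega1"
  have "inj (inv \<iota>)"
    using \<iota> by (simp add: bij_imp_bij_inv bij_is_inj)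
  then have J: "inj J"
    using inj_compose[OF _ inj_sequences_nat_set[OF bij_is_inj[OF \<iota>]]]
    unfolding J_def comp_def by blast
  have "|UNIV :: (nat \<times> nat) set| \<le>o |UNIV :: omega1 set|"
    using uncountable_omega1 countable_card_of_nat[of "UNIV :: (nat \<times> nat) set"]
      infinite_iff_card_of_nat[of "UNIV :: omega1 set"] countable_finite ordLeq_transitive by blast
  then obtain \<nu> :: "omega1 \<Rightarrow> nat \<times> nat" where \<nu>: "surj \<nu>"
    by (metis UNIV_I card_of_ordLeq2 empty_iff)
  \<comment> \<open>A code is decoded to one sequence, which the pairing function splits into
    countably many slots.\<close>
  define h where "h \<alpha> i k = inv J \<alpha> (prod_encode (i, k))" for \<alpha> i k
  define T where "T \<alpha> = ((h \<alpha> 0, h \<alpha> 1), (h \<alpha> 2, h \<alpha> 3 0))" for \<alpha>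
  have cof: "\<exists>\<alpha>. T \<alpha> = ((e, b), (c, w)) \<and> (\<forall>x\<in>D. x < \<alpha>)" if "countable D" for e b c w D
  proof -
    \<comment> \<open>Slot 4 carries the dummy parameter: it makes \<open>f\<close> injective in
      \<open>z\<close>, so each task has uncountably many codes and hence one above any countable
      set.\<close>
    define f where "f z n = (case prod_decode n of (i, k) \<Rightarrow> 
      (if i = 0 then e k else if i = 1 then b k else if i = 2 then c k
       else if i = 3 then w else z))" for z n
    have hf: "T (J (f z)) = ((e, b), (c, w))" for z
      using J by (simp add: T_def h_def f_def fun_eq_iff)
    have "inj f"
    proof (rule injI)
      fix z z' assume "f z = f z'"
      then have "f z (prod_encode (4, 0)) = f z' (prod_encode (4, 0))"
        by simp
      then show "z = z'"
        by (simp add: f_def)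
    qed
    then have "inj (\<lambda>z. J (f z))"
      using J by (simp add: inj_def)
    then have "uncountable (range (\<lambda>z. J (f z)))"
      using uncountable_omega1 countable_image_inj_eq by blast
    from uncountable_above_countable_omega1[OF that this] show ?thesis
      using hf by auto
  qed
  define E where "E \<alpha> = fst (fst (T \<alpha>))" for \<alpha>
  define L where "L \<alpha> = \<nu> (snd (snd (T \<alpha>)))" for \<alpha>
  \<comment> \<open>A function with values 0, 1, 2 on a countable set is coded by the two subsets
    where it is 1 and 2.\<close>
  define Q where "Q \<alpha> \<beta> = (if \<beta> \<in> tail (fst (snd (T \<alpha>))) then 2
     else if \<beta> \<in> tail (snd (fst (T \<alpha>))) then 1 else 0::nat)" for \<alpha> \<beta>
  show thesis
  proof (rule that[of Q E L])
    show "Q \<alpha> \<beta> < 3" for \<alpha> \<beta>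
      by (simp add: Q_def)
    fix e and q :: "omega1 \<Rightarrow> nat" and l and P D :: "omega1 set"
    assume P: "countable P" and q: "\<And>\<beta>. q \<beta> < 3" and D: "countable D"
    obtain w where w: "\<nu> w = l"
      using \<nu> by (metis surjD)
    obtain y where y: "y \<notin> P"
      using P uncountable_omega1 by (metis UNIV_eq_I)
    have "\<exists>b. tail b = {\<beta> \<in> P. q \<beta> = v}" for v
      by (rule tail_exists[of "{\<beta> \<in> P. q \<beta> = v}" y]) (use P y in \<open>auto intro: countable_subset\<close>)
    then obtain b c where "tail b = {\<beta> \<in> P. q \<beta> = 1}" "tail c = {\<beta> \<in> P. q \<beta> = 2}"
      by meson
    moreover obtain \<alpha> where "T \<alpha> = ((e, b), (c, w))" "\<forall>x\<in>D. x < \<alpha>"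
      using cof[OF D] by blast
    moreover have "q \<beta> \<noteq> 2 \<Longrightarrow> q \<beta> \<noteq> 1 \<Longrightarrow> q \<beta> = 0" for \<beta>
      using q[of \<beta>] by linarith
    ultimately show "\<exists>\<alpha>. E \<alpha> = e \<and> (\<forall>\<beta>\<in>P. Q \<alpha> \<beta> = q \<beta>) \<and> L \<alpha> = l \<and> (\<forall>x\<in>D. x < \<alpha>)"
      by (intro exI[of _ \<alpha>]) (auto simp: E_def L_def Q_def w)
  qed
qed

section \<open>P-points\<close>

text \<open>A free filter in which countably many members have a pseudo-intersection. Besides
  P-points this covers cofinite filters on a set and \<open>bot\<close>, so that all stages of the
  recursion are treated alike.\<close>

definition p_filter :: "'a filter \<Rightarrow> bool"
  where "p_filter F \<longleftrightarrow> (\<forall>x. \<forall>\<^sub>F y in F. y \<noteq> x) \<and>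
    (\<forall>\<D>. countable \<D> \<and> (\<forall>D\<in>\<D>. \<forall>\<^sub>F y in F. y \<in> D) \<longrightarrow>
      (\<exists>B. (\<forall>\<^sub>F y in F. y \<in> B) \<and> (\<forall>D\<in>\<D>. finite (B - D))))"

text \<open>Properness is not included: \<open>bot\<close> counts as \<open>ultra\<close>.\<close>

definition ultra :: "'a filter \<Rightarrow> bool"
  where "ultra F \<longleftrightarrow> (\<forall>P. eventually P F \<or> (\<forall>\<^sub>F y in F. \<not> P y))"

lemma p_filter_finite:
  assumes "p_filter F" and "finite X"
  shows "\<forall>\<^sub>F y in F. y \<notin> X"
proof -
  have "\<forall>\<^sub>F y in F. \<forall>x\<in>X. y \<noteq> x"
    using assms by (intro eventually_ball_finite) (auto simp: p_filter_def)
  then show ?thesis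
    by (rule eventually_mono) blast
qed

lemma p_filter_frequently_infinite:
  assumes "p_filter F" and "\<exists>\<^sub>F y in F. y \<in> S"
  shows "infinite S"
  using p_filter_finite[OF assms(1), of S] assms(2) by (auto simp: frequently_def)

lemma p_filter_pseudo_intersection:
  assumes "p_filter F" and "countable I" and "\<And>i. i \<in> I \<Longrightarrow> \<forall>\<^sub>F y in F. y \<in> D i"
  shows "\<exists>B. (\<forall>\<^sub>F y in F. y \<in> B) \<and> (\<forall>i\<in>I. finite (B - D i))"
proof -
  have "countable (D ` I)" "\<forall>X\<in>D ` I. \<forall>\<^sub>F y in F. y \<in> X"
    using assms(2,3) by auto
  then obtain B where "\<forall>\<^sub>F y in F. y \<in> B" "\<forall>X\<in>D ` I. finite (B - X)"
    using assms(1) unfolding p_filter_def by meson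
  then show ?thesis
    by blast
qed

lemma p_filter_bot [simp]: "p_filter bot"
  by (auto simp: p_filter_def intro: exI[of _ "{}"])

text \<open>Transports a P-point on the numbers to the range of a sequence. Injectivity keeps the
  image free.\<close>

lemma p_filter_filtermap_inj:
  assumes "p_filter F" and "inj f"
  shows "p_filter (filtermap f F)"
  unfolding p_filter_def eventually_filtermap
proof (intro conjI allI impI)
  fix x
  show "\<forall>\<^sub>F k in F. f k \<noteq> x"
  proof (cases "x \<in> range f")
    case True
    then obtain k where k: "x = f k"
      by blast
    have "\<forall>\<^sub>F j in F. j \<noteq> k"
      using assms(1) by (simp add: p_filter_def)
    then show ?thesis
      using assms(2) k by (auto elim!: eventually_mono dest: injD)
  qed (auto intro: always_eventually)
next
  fix \<D> :: "'b set set"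
  assume \<D>: "countable \<D> \<and> (\<forall>D\<in>\<D>. \<forall>\<^sub>F k in F. f k \<in> D)"
  then obtain B where B: "\<forall>\<^sub>F k in F. k \<in> B" "\<And>D. D \<in> \<D> \<Longrightarrow> finite (B - f -` D)"
    using p_filter_pseudo_intersection[OF assms(1), of \<D> "\<lambda>D. f -` D"] by auto
  have "f ` B - D = f ` (B - f -` D)" for D
    by auto
  moreover have "\<forall>\<^sub>F k in F. f k \<in> f ` B"
    using B(1) by (auto elim: eventually_mono)
  ultimately show "\<exists>B. (\<forall>\<^sub>F k in F. f k \<in> B) \<and> (\<forall>D\<in>\<D>. finite (B - D))"
    using B(2) by (metis finite_imageI)
qed

lemma eventually_cofinite_on:
  "eventually P (inf cofinite (principal S)) \<longleftrightarrow> finite {y \<in> S. \<not> P y}"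
  by (simp add: eventually_inf_principal eventually_cofinite conj_commute cong: conj_cong)

text \<open>\<open>S\<close> itself is a pseudo-intersection of all members.\<close>

lemma p_filter_cofinite_on: "p_filter (inf cofinite (principal S))"
proof -
  have "finite {y \<in> S. y = x}" for x
    by (rule finite_subset[of _ "{x}"]) auto
  then show ?thesis
    unfolding p_filter_def eventually_cofinite_on
    by (auto intro!: exI[of _ S] simp: set_diff_eq)
qed

lemma ultra_frequently:
  assumes "ultra F" and "frequently P F"
  shows "eventually P F"
  using assms by (auto simp: ultra_def frequently_def)

lemma ultra_filtermap: "ultra F \<Longrightarrow> ultra (filtermap f F)"
  unfolding ultra_def eventually_filtermap by blast

lemma ultra_limit_exists:
  fixes f :: "'a \<Rightarrow> nat"
  assumes "ultra F" and "\<And>x. f x < n"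
  shows "\<exists>v<n. \<forall>\<^sub>F x in F. f x = v"
proof (rule ccontr)
  assume neg: "\<not> ?thesis"
  then have "\<forall>v\<in>{..<n}. \<forall>\<^sub>F x in F. f x \<noteq> v"
    using assms(1) by (auto simp: ultra_def)
  then have *: "\<forall>\<^sub>F x in F. \<forall>v\<in>{..<n}. f x \<noteq> v"
    by (intro eventually_ball_finite) auto
  have "\<forall>\<^sub>F x in F. False"
    using * by (rule eventually_mono) (use assms(2) in auto)
  \<comment> \<open>The filter has turned out to be \<open>bot\<close>, along which every value is a
    limit.\<close>
  then have "\<forall>\<^sub>F x in F. f x = v" for v
    by (rule eventually_mono) simp
  moreover have "0 < n"
    using assms(2) less_nat_zero_code by (metis gr0I)
  ultimately show False
    using neg by blast
qed

text \<open>Diagonal choice: \<open>b n\<close> lies in the sets with index up to \<open>n\<close>,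
  so only finitely many \<open>b n\<close> miss a given set, and \<open>n \<le> b n\<close> makes
  the range infinite.\<close>

lemma pseudo_intersection:
  fixes \<D> :: "nat set set"
  assumes "countable \<D>" and "\<And>\<G>. finite \<G> \<Longrightarrow> \<G> \<subseteq> \<D> \<Longrightarrow> infinite (\<Inter>\<G>)"
  obtains B where "infinite B" "\<And>D. D \<in> \<D> \<Longrightarrow> finite (B - D)"
proof (cases "\<D> = {}")
  case True
  then show thesis
    using that[of UNIV] by auto
next
  case False
  define D where "D = from_nat_into \<D>"
  have D: "range D = \<D>"
    using False assms(1) by (simp add: D_def range_from_nat_into)
  have "\<exists>m\<ge>n. m \<in> \<Inter>(D ` {..n})" for n
  proof -
    have "infinite (\<Inter>(D ` {..n}))"
      using D by (intro assms(2)) auto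
    then show ?thesis
      using infinite_nat_iff_unbounded_le by blast
  qed
  then obtain b where b: "\<And>n. n \<le> b n" "\<And>n. b n \<in> \<Inter>(D ` {..n})"
    by metis
  show thesis
  proof (rule that[of "range b"])
    show "infinite (range b)"
      using b(1) unfolding infinite_nat_iff_unbounded_le by blast
    fix X assume "X \<in> \<D>"
    then obtain k where k: "X = D k"
      using D by blast
    have "range b - X \<subseteq> b ` {..<k}"
      using b(2) by (auto simp: k image_iff) (metis INT_iff atMost_iff lessThan_iff not_le)
    then show "finite (range b - X)"
      using finite_subset by blast
  qed
qed

text \<open>The ultrafilter is generated by an almost decreasing tower of length \<open>\<omega>\<^sub>1\<close> that decides
  every set of natural numbers; countably many members of the tower lie above a single one.\<close>

lemma p_point_CH:
  assumes Continuum_Hypothesis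
  obtains p :: "nat filter" where "p \<noteq> bot" "ultra p" "p_filter p"
proof -
  obtain \<iota> :: "omega1 \<Rightarrow> nat set" where \<iota>: "bij \<iota>"
    using bij_omega1_nat_set_CH[OF assms] .
  define R where "R f \<alpha> T \<longleftrightarrow> infinite T \<and> (\<forall>\<beta><\<alpha>. finite (T - f \<beta>)) \<and> (T \<subseteq> \<iota> \<alpha> \<or> T \<inter> \<iota> \<alpha> = {})"
    for f \<alpha> and T :: "nat set"
  have "\<exists>T. \<forall>\<alpha>. R T \<alpha> (T \<alpha>)"
  proof (rule dependent_wellorder_choice)
    show "R f \<alpha> T = R g \<alpha> T" if "\<And>\<beta>. \<beta> < \<alpha> \<Longrightarrow> f \<beta> = g \<beta>" for f g \<alpha> T
      using that by (auto simp: R_def)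
    fix \<alpha> f
    assume f: "R f \<beta> (f \<beta>)" if "\<beta> < \<alpha>" for \<beta>
    \<comment> \<open>Among finitely many members of the tower, the one with the largest index is
      infinite and almost contained in the others.\<close>
    have "infinite (\<Inter>\<G>)" if G: "finite \<G>" "\<G> \<subseteq> f ` {..<\<alpha>}" for \<G>
    proof -
      obtain I where I: "finite I" "I \<subseteq> {..<\<alpha>}" "\<G> = f ` I"
        using finite_subset_image[OF G] by blast
      show ?thesis
      proof (cases "I = {}")
        case False
        define m where "m = Max I"
        have m: "m \<in> I" "\<And>i. i \<in> I \<Longrightarrow> i \<le> m"
          using I False by (simp_all add: m_def)
        then have Rm: "R f m (f m)"
          using f I by blast
        have "finite (\<Union>i\<in>I. f m - f i)"
          using I m Rm unfolding R_def by (metis Diff_cancel finite.emptyI finite_UN order_le_less)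
        moreover have "f m - \<Inter>\<G> \<subseteq> (\<Union>i\<in>I. f m - f i)"
          using I by auto
        ultimately have "finite (f m - \<Inter>\<G>)"
          using finite_subset by blast
        then show ?thesis
          using Rm unfolding R_def by (metis finite_Diff2)
      qed (use I in simp)
    qed
    from pseudo_intersection[OF countable_image[OF countable_lessThan_omega1] this]
    obtain B where B: "infinite B" "\<And>\<beta>. \<beta> < \<alpha> \<Longrightarrow> finite (B - f \<beta>)"
      by (metis image_eqI lessThan_iff)
    have "infinite (B \<inter> \<iota> \<alpha>) \<or> infinite (B - \<iota> \<alpha>)"
      using B(1) by (metis Int_Diff_Un finite_Un)
    moreover have "finite (B \<inter> \<iota> \<alpha> - f \<beta>)" "finite (B - \<iota> \<alpha> - f \<beta>)" if "\<beta> < \<alpha>" for \<beta>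
      using B(2)[OF that] by (auto elim: rev_finite_subset)
    ultimately have "R f \<alpha> (B \<inter> \<iota> \<alpha>) \<or> R f \<alpha> (B - \<iota> \<alpha>)"
      unfolding R_def by blast
    then show "\<exists>T. R f \<alpha> T"
      by blast
  qed
  then obtain T where T: "\<And>\<alpha>. R T \<alpha> (T \<alpha>)"
    by blast
  have inf_T: "infinite (T \<alpha>)" and dec_T: "T \<alpha> \<subseteq> \<iota> \<alpha> \<or> T \<alpha> \<inter> \<iota> \<alpha> = {}" for \<alpha>
    using T[of \<alpha>] by (auto simp: R_def)
  have fin_T: "finite (T \<alpha> - T \<beta>)" if "\<beta> \<le> \<alpha>" for \<alpha> \<beta>
    using T[of \<alpha>] that by (cases "\<beta> = \<alpha>") (auto simp: R_def)
  \<comment> \<open>Working modulo finite sets makes \<open>p\<close> free. For intersections the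
    larger of two indices serves, since the tower is almost decreasing.\<close>
  define p where "p = Abs_filter (\<lambda>P. \<exists>\<alpha>. finite (T \<alpha> - Collect P))"
  have ev: "eventually P p \<longleftrightarrow> (\<exists>\<alpha>. finite (T \<alpha> - Collect P))" for P
    unfolding p_def
  proof (rule eventually_Abs_filter, unfold_locales)
    show "\<exists>\<alpha>. finite (T \<alpha> - Collect (\<lambda>x. True))"
      by simp
    show "\<exists>\<alpha>. finite (T \<alpha> - {x. P x \<and> Q x})"
      if PQ: "\<exists>\<alpha>. finite (T \<alpha> - Collect P)" "\<exists>\<alpha>. finite (T \<alpha> - Collect Q)" for P Q
    proof -
      obtain \<alpha> \<beta> where ab: "finite (T \<alpha> - Collect P)" "finite (T \<beta> - Collect Q)"
        using PQ by blast
      define \<gamma> where "\<gamma> = max \<alpha> \<beta>"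
      have "T \<gamma> - {x. P x \<and> Q x} \<subseteq> (T \<gamma> - T \<alpha>) \<union> (T \<alpha> - Collect P) \<union> (T \<gamma> - T \<beta>) \<union> (T \<beta> - Collect Q)"
        by auto
      moreover have "finite ((T \<gamma> - T \<alpha>) \<union> (T \<alpha> - Collect P) \<union> (T \<gamma> - T \<beta>) \<union> (T \<beta> - Collect Q))"
        using ab fin_T[of \<alpha> \<gamma>] fin_T[of \<beta> \<gamma>] by (simp add: \<gamma>_def)
      ultimately show ?thesis
        using finite_subset by blast
    qed
    show "\<exists>\<alpha>. finite (T \<alpha> - Collect Q)"
      if PQ: "\<forall>x. P x \<longrightarrow> Q x" "\<exists>\<alpha>. finite (T \<alpha> - Collect P)" for P Q
    proof -
      obtain \<alpha> where "finite (T \<alpha> - Collect P)"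
        using PQ(2) by blast
      then have "finite (T \<alpha> - Collect Q)"
        by (rule rev_finite_subset) (use PQ(1) in auto)
      then show ?thesis ..
    qed
  qed
  show thesis
  proof (rule that)
    show "p \<noteq> bot"
      using ev[of "\<lambda>_. False"] inf_T by (auto simp: trivial_limit_def)
    show "ultra p"
      unfolding ultra_def
    proof
      fix P
      obtain \<alpha> where "\<iota> \<alpha> = Collect P"
        using \<iota> by (metis bij_pointE)
      then have "T \<alpha> - Collect P = {} \<or> T \<alpha> - {x. \<not> P x} = {}"
        using dec_T[of \<alpha>] by auto
      then show "eventually P p \<or> (\<forall>\<^sub>F y in p. \<not> P y)"
        unfolding ev by (metis finite.emptyI)
    qed
    have "\<exists>B. (\<forall>\<^sub>F y in p. y \<in> B) \<and> (\<forall>D\<in>\<D>. finite (B - D))"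
      if \<D>: "countable \<D>" "\<forall>D\<in>\<D>. \<forall>\<^sub>F y in p. y \<in> D" for \<D>
    proof -
      obtain a where a: "\<And>D. D \<in> \<D> \<Longrightarrow> finite (T (a D) - D)"
        using \<D>(2) unfolding ev by (metis Collect_mem_eq)
      \<comment> \<open>Countably many members are witnessed by countably many indices; a tower set
        beyond all of these is a pseudo-intersection.\<close>
      obtain \<alpha> where \<alpha>: "\<And>D. D \<in> \<D> \<Longrightarrow> a D < \<alpha>"
        using uncountable_above_countable_omega1[of "a ` \<D>" UNIV] \<D>(1) uncountable_omega1
        by auto
      have "finite (T \<alpha> - D)" if "D \<in> \<D>" for D
      proof (rule finite_subset)
        show "T \<alpha> - D \<subseteq> (T \<alpha> - T (a D)) \<union> (T (a D) - D)"
          by auto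
        show "finite ((T \<alpha> - T (a D)) \<union> (T (a D) - D))"
          using a[OF that] \<alpha>[OF that] fin_T[of "a D" \<alpha>] by simp
      qed
      then show ?thesis
        unfolding ev by (intro exI[of _ "T \<alpha>"]) (auto intro: exI[of _ \<alpha>])
    qed
    moreover have "\<forall>\<^sub>F y in p. y \<noteq> x" for x
      unfolding ev by (rule exI, rule finite_subset[of _ "{x}"]) auto
    ultimately show "p_filter p"
      by (simp add: p_filter_def)
  qed
qed

section \<open>Continuous functions for countably many filters\<close>

text \<open>\<open>D x z - D z x\<close> belongs to \<open>F x\<close> and is disjoint from its
  mirror image, which belongs to \<open>F z\<close>. A pseudo-intersection over the countably many
  \<open>z\<close> handles all pairs at once.\<close>

lemma p_filters_almost_disjoint:
  assumes "countable A" and "\<And>x. x \<in> A \<Longrightarrow> p_filter (F x)"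
    and "\<And>x z. x \<in> A \<Longrightarrow> z \<in> A \<Longrightarrow> x \<noteq> z \<Longrightarrow>
      \<exists>D. (\<forall>\<^sub>F y in F x. y \<in> D) \<and> (\<forall>\<^sub>F y in F z. y \<notin> D)"
  obtains B where "\<And>x. x \<in> A \<Longrightarrow> \<forall>\<^sub>F y in F x. y \<in> B x"
    and "\<And>x z. x \<in> A \<Longrightarrow> z \<in> A \<Longrightarrow> x \<noteq> z \<Longrightarrow> finite (B x \<inter> B z)"
proof -
  obtain D where D: "\<forall>\<^sub>F y in F x. y \<in> D x z" "\<forall>\<^sub>F y in F z. y \<notin> D x z"
    if "x \<in> A" "z \<in> A" "x \<noteq> z" for x z
    using assms(3) by metis
  have "\<exists>B. (\<forall>\<^sub>F y in F x. y \<in> B) \<and> (\<forall>z\<in>A - {x}. finite (B - (D x z - D z x)))"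
    if "x \<in> A" for x
  proof -
    have D': "\<forall>\<^sub>F y in F x. y \<in> D x z - D z x" if "z \<in> A - {x}" for z
      using D(1)[of x z] D(2)[of z x] \<open>x \<in> A\<close> that by (auto intro: eventually_conj)
    show ?thesis
      by (rule p_filter_pseudo_intersection[where D = "\<lambda>z. D x z - D z x",
          OF assms(2)[OF \<open>x \<in> A\<close>] countable_Diff[OF assms(1)] D'])
  qed
  then obtain B where B: "\<And>x. x \<in> A \<Longrightarrow> \<forall>\<^sub>F y in F x. y \<in> B x"
    "\<And>x z. x \<in> A \<Longrightarrow> z \<in> A - {x} \<Longrightarrow> finite (B x - (D x z - D z x))"
    by metis
  have "finite (B x \<inter> B z)" if "x \<in> A" "z \<in> A" "x \<noteq> z" for x z
  proof (rule finite_subset)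
    show "B x \<inter> B z \<subseteq> (B x - (D x z - D z x)) \<union> (B z - (D z x - D x z))"
      by auto
    show "finite ((B x - (D x z - D z x)) \<union> (B z - (D z x - D x z)))"
      using B(2)[of x z] B(2)[of z x] that by simp
  qed
  with B(1) show thesis
    by (rule that)
qed

text \<open>After the members \<open>B x\<close> of the filters have been made disjoint, with \<open>B x\<close> omitting the points
  enumerated up to \<open>x\<close>, the value at a point of \<open>B x\<close> is copied from \<open>x\<close>; this recursion is
  well-founded and leaves the values outside all of the \<open>B x\<close> free.\<close>

lemma p_filters_continuous_separation:
  assumes A: "countable A" and F: "\<And>x. x \<in> A \<Longrightarrow> p_filter (F x)"
    and disj: "\<And>x z. x \<in> A \<Longrightarrow> z \<in> A \<Longrightarrow> x \<noteq> z \<Longrightarrow>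
      \<exists>D. (\<forall>\<^sub>F y in F x. y \<in> D) \<and> (\<forall>\<^sub>F y in F z. y \<notin> D)"
    and S: "\<And>x. x \<in> A \<Longrightarrow> \<forall>\<^sub>F y in F x. y \<notin> S" and c: "c \<notin> S"
  obtains g :: "'a \<Rightarrow> nat" where "\<And>y. g y < 2" "\<And>x. x \<in> A \<Longrightarrow> \<forall>\<^sub>F y in F x. g y = g x"
    "\<And>y. y \<in> S \<Longrightarrow> g y = 1" "g c = 0"
proof -
  from p_filters_almost_disjoint[where F = F, OF A F disj]
  obtain B where B: "\<And>x. x \<in> A \<Longrightarrow> \<forall>\<^sub>F y in F x. y \<in> B x"
    "\<And>x z. x \<in> A \<Longrightarrow> z \<in> A \<Longrightarrow> x \<noteq> z \<Longrightarrow> finite (B x \<inter> B z)"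
    by blast
  define i where "i = to_nat_on A"
  have inj: "inj_on i A"
    using inj_on_to_nat_on[OF A] by (simp add: i_def)
  have fin: "finite {z \<in> A. i z \<le> n}" for n
  proof (rule finite_imageD)
    show "finite (i ` {z \<in> A. i z \<le> n})"
      by (rule finite_subset[of _ "{..n}"]) auto
    show "inj_on i {z \<in> A. i z \<le> n}"
      using inj by (rule inj_on_subset) auto
  qed
  \<comment> \<open>Omitting \<open>S\<close> and \<open>c\<close> keeps the values there free. The
    set still belongs to \<open>F x\<close>: apart from \<open>S\<close>, which \<open>F x\<close>
    avoids, only finitely many points of \<open>B x\<close> are removed.\<close>
  define C where "C x = B x - (\<Union>z\<in>{z \<in> A. i z < i x}. B z) - S - {c} - {z \<in> A. i z \<le> i x}" for x
  have C: "\<forall>\<^sub>F y in F x. y \<in> C x" if "x \<in> A" for x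
  proof -
    let ?X = "(\<Union>z\<in>{z \<in> A. i z < i x}. B x \<inter> B z) \<union> {c} \<union> {z \<in> A. i z \<le> i x}"
    have "finite {z \<in> A. i z < i x}"
      by (rule finite_subset[OF _ fin[of "i x"]]) auto
    then have "finite (\<Union>z\<in>{z \<in> A. i z < i x}. B x \<inter> B z)"
      by (rule finite_UN_I) (use B(2)[OF that] in auto)
    then have "finite ?X"
      using fin by blast
    then have "\<forall>\<^sub>F y in F x. y \<notin> ?X"
      by (rule p_filter_finite[OF F[OF that]])
    with B(1)[OF that] S[OF that] show ?thesis
      by eventually_elim (auto simp: C_def)
  qed
  have C_disj: "x = z" if "x \<in> A" "z \<in> A" "y \<in> C x" "y \<in> C z" for x z y
  proof (rule ccontr)
    assume "x \<noteq> z"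
    then have "i x < i z \<or> i z < i x"
      using inj that(1,2) by (meson inj_onD linorder_neqE)
    then show False
      using that by (auto simp: C_def)
  qed
  define R where "R = {(x, y). x \<in> A \<and> y \<in> C x}"
  \<comment> \<open>Along \<open>R\<close> the rank strictly increases: a point of
    \<open>C x\<close> in \<open>A\<close> is enumerated after \<open>x\<close>, and a point outside
    \<open>A\<close> has rank infinity.\<close>
  define r where "r y = (if y \<in> A then enat (i y) else \<infinity>)" for y
  have "R \<subseteq> inv_image {(a, b). a < b} r"
    by (auto simp: R_def r_def C_def)
  then have wf: "wf R"
    by (rule wf_subset[OF wf_inv_image[OF wf]])
  have R_THE: "(THE x. x \<in> A \<and> y \<in> C x) = x" if "(x, y) \<in> R" for x y
    using that C_disj by (intro the_equality) (auto simp: R_def)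
  \<comment> \<open>The default value 0 applies to \<open>c\<close>, which lies outside
    \<open>S\<close> and every \<open>C x\<close>.\<close>
  define P where "P g y v \<longleftrightarrow> v = (if \<exists>x. (x, y) \<in> R then g (THE x. x \<in> A \<and> y \<in> C x)
      else if y \<in> S then 1 else 0)" for g y and v :: nat
  have "\<exists>g. \<forall>y. P g y (g y)"
  proof (rule dependent_wf_choice[OF wf])
    show "P g y v = P h y v" if "\<And>x. (x, y) \<in> R \<Longrightarrow> g x = h x" for g h y v
      unfolding P_def using R_THE that by (cases "\<exists>x. (x, y) \<in> R") auto
  qed (auto simp: P_def)
  then obtain g where g: "\<And>y. P g y (g y)"
    by blast
  have g_C: "g y = g x" if "x \<in> A" "y \<in> C x" for x y
    using g[of y] R_THE[of x y] that unfolding P_def by (auto simp: R_def)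
  have g_free: "g y = (if y \<in> S then 1 else 0)" if "y \<in> S \<or> y = c" for y
    using g[of y] that unfolding P_def by (auto simp: R_def C_def)
  show thesis
  proof (rule that)
    show "g y < 2" for y
    proof (induction y rule: wf_induct_rule[OF wf])
      case (1 y)
      show ?case
        using 1 g[of y] R_THE unfolding P_def
        by (cases "\<exists>x. (x, y) \<in> R") (auto split: if_splits)
    qed
    show "\<forall>\<^sub>F y in F x. g y = g x" if "x \<in> A" for x
      using C[OF that] by (rule eventually_mono) (rule g_C[OF that])
    show "g y = 1" if "y \<in> S" for y
      using g_free that by simp
    show "g c = 0"
      using g_free c by simp
  qed
qed

lemma infinite_split:
  assumes "infinite S"
  obtains S0 S1 where "S0 \<subseteq> S" "S1 \<subseteq> S" "S0 \<inter> S1 = {}" "infinite S0" "infinite S1"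
proof -
  obtain f :: "nat \<Rightarrow> 'a" where f: "inj f" "range f \<subseteq> S"
    using assms infinite_countable_subset by blast
  have "range (\<lambda>n. f (2 * n)) \<inter> range (\<lambda>n. f (2 * n + 1)) = {}"
    using f(1) by (auto simp: inj_eq) presburger
  moreover have "inj (\<lambda>n. f (2 * n))" "inj (\<lambda>n. f (2 * n + 1))"
    using f(1) by (simp_all add: inj_def inj_eq[OF f(1)])
  then have "infinite (range (\<lambda>n. f (2 * n)))" "infinite (range (\<lambda>n. f (2 * n + 1)))"
    using finite_imageD infinite_UNIV_nat by blast+
  moreover have "range (\<lambda>n. f (2 * n)) \<subseteq> S" "range (\<lambda>n. f (2 * n + 1)) \<subseteq> S"
    using f(2) by auto
  ultimately show thesis
    using that by blast
qed

text \<open>Split \<open>S \<inter> B x\<close> into two infinite halves; the ultrafilter avoids one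
  of them, and every other filter does so because it almost avoids \<open>B x\<close>. Separation
  then gives value 1 on that half and 0 at \<open>x\<close>, and the 0 spreads along
  \<open>F x\<close> to infinitely many points of \<open>S\<close>.\<close>

lemma p_filters_continuous_splitting:
  assumes A: "countable A" and F: "\<And>x. x \<in> A \<Longrightarrow> p_filter (F x)"
    and disj: "\<And>x z. x \<in> A \<Longrightarrow> z \<in> A \<Longrightarrow> x \<noteq> z \<Longrightarrow>
      \<exists>D. (\<forall>\<^sub>F y in F x. y \<in> D) \<and> (\<forall>\<^sub>F y in F z. y \<notin> D)"
    and x: "x \<in> A" "ultra (F x)" "\<exists>\<^sub>F y in F x. y \<in> S"
  obtains g :: "'a \<Rightarrow> nat" where "\<And>y. g y < 2" "\<And>x. x \<in> A \<Longrightarrow> \<forall>\<^sub>F y in F x. g y = g x"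
    "\<And>v. v < 2 \<Longrightarrow> infinite {y \<in> S. g y = v}"
proof -
  from p_filters_almost_disjoint[where F = F, OF A F disj]
  obtain B where B: "\<And>x. x \<in> A \<Longrightarrow> \<forall>\<^sub>F y in F x. y \<in> B x"
    "\<And>x z. x \<in> A \<Longrightarrow> z \<in> A \<Longrightarrow> x \<noteq> z \<Longrightarrow> finite (B x \<inter> B z)"
    by blast
  have S_F: "\<forall>\<^sub>F y in F x. y \<in> S"
    using x(2,3) by (rule ultra_frequently)
  have nontriv: "F x \<noteq> bot"
    using x(3) by (auto simp: frequently_def)
  have "\<forall>\<^sub>F y in F x. y \<in> S \<inter> B x"
    using S_F B(1)[OF x(1)] by eventually_elim simp
  then have "infinite (S \<inter> B x)"
    using nontriv by (intro p_filter_frequently_infinite[OF F[OF x(1)]] eventually_frequently)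
  then obtain S0 S1 where S01: "S0 \<subseteq> S \<inter> B x" "S1 \<subseteq> S \<inter> B x" "S0 \<inter> S1 = {}"
    "infinite S0" "infinite S1"
    by (rule infinite_split)
  have "(\<forall>\<^sub>F y in F x. y \<notin> S0) \<or> (\<forall>\<^sub>F y in F x. y \<notin> S1)"
  proof (rule ccontr)
    assume "\<not> ?thesis"
    then have "\<forall>\<^sub>F y in F x. y \<in> S0" "\<forall>\<^sub>F y in F x. y \<in> S1"
      using x(2) by (auto simp: ultra_def)
    then have "\<forall>\<^sub>F y in F x. False"
      by eventually_elim (use S01(3) in auto)
    then show False
      using nontriv by (simp add: trivial_limit_def)
  qed
  then obtain S' where S': "S' \<subseteq> S \<inter> B x" "infinite S'" "\<forall>\<^sub>F y in F x. y \<notin> S'"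
    using S01 by metis
  \<comment> \<open>The point \<open>x\<close> is taken out since it is to receive the value
    0.\<close>
  have "\<forall>\<^sub>F y in F z. y \<notin> S' - {x}" if "z \<in> A" for z
  proof (cases "z = x")
    case True
    then show ?thesis
      using S'(3) by (auto elim: eventually_mono)
  next
    case False
    have "\<forall>\<^sub>F y in F z. y \<notin> B x \<inter> B z"
      by (rule p_filter_finite[OF F[OF that] B(2)[OF x(1) that False[symmetric]]])
    with B(1)[OF that] show ?thesis
      by eventually_elim (use S'(1) in auto)
  qed
  from p_filters_continuous_separation[where F = F and c = x, OF A F disj this]
  obtain g :: "'a \<Rightarrow> nat" where g: "\<And>y. g y < 2" "\<And>x. x \<in> A \<Longrightarrow> \<forall>\<^sub>F y in F x. g y = g x"
    "\<And>y. y \<in> S' - {x} \<Longrightarrow> g y = 1" "g x = 0"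
    by blast
  have "infinite {y \<in> S. g y = 1}"
  proof (rule infinite_super)
    show "S' - {x} \<subseteq> {y \<in> S. g y = 1}"
      using g(3) S'(1) by blast
  qed (use S'(2) in simp)
  moreover have "\<forall>\<^sub>F y in F x. y \<in> {y \<in> S. g y = 0}"
    using g(2)[OF x(1)] S_F by eventually_elim (simp add: g(4))
  then have "infinite {y \<in> S. g y = 0}"
    using nontriv by (intro p_filter_frequently_infinite[OF F[OF x(1)]] eventually_frequently)
  ultimately have "infinite {y \<in> S. g y = v}" if "v < 2" for v
    using that by (auto simp: less_2_cases_iff)
  with g(1,2) show thesis
    by (rule that)
qed

section \<open>The recursion\<close>

lemma range_eq_insert_tail: "range e = insert (e 0) (tail e)"
  by (auto simp: tail_def image_iff) (metis not0_implies_Suc)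

text \<open>Lets a stage without a limit count as one with a cofinite filter.\<close>

lemma bot_eq_cofinite_on: "\<exists>T. bot = inf cofinite (principal T)"
  by (rule exI[of _ "{}"]) simp

text \<open>A stage \<open>\<alpha>\<close> chooses the row \<open>g\<close> of the matrix (its values at points below \<open>\<alpha>\<close> matter), the column
  \<open>c\<close> (its values at coordinates up to \<open>\<alpha>\<close> matter) and the filter that is to converge to \<open>\<alpha>\<close>,
  where the filter \<open>bot\<close> imposes nothing. \<open>S\<close> consists of the stages at which the sequence is to be given
  a cluster point and \<open>U\<close> of those at which the filter is to be an ultrafilter.\<close>

context
  fixes E :: "omega1 \<Rightarrow> nat \<Rightarrow> omega1" and Q :: "omega1 \<Rightarrow> omega1 \<Rightarrow> nat"
    and S U :: "omega1 set"
begin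

type_synonym stage = "(omega1 \<Rightarrow> nat) \<times> (omega1 \<Rightarrow> nat) \<times> omega1 filter"

text \<open>An entry is fixed at the later of the two stages: by the row of \<open>\<beta>\<close>
  if \<open>x < \<beta>\<close>, by the column of \<open>x\<close> otherwise, the diagonal
  included.\<close>

definition entry :: "(omega1 \<Rightarrow> stage) \<Rightarrow> omega1 \<Rightarrow> omega1 \<Rightarrow> nat"
  where "entry f \<beta> x = (if x < \<beta> then fst (f \<beta>) x else fst (snd (f x)) \<beta>)"

abbreviation filt :: "(omega1 \<Rightarrow> stage) \<Rightarrow> omega1 \<Rightarrow> omega1 filter"
  where "filt f x \<equiv> snd (snd (f x))"

text \<open>Values below 2 reserve the value 2 for the diagonal at stages that are not limit stages,
  where it tells the new point from all earlier ones. The two conditional demands do not conflict: a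
  free filter that meets the range of \<open>E \<alpha>\<close> frequently also meets its tail
  frequently.\<close>

definition row_ok :: "(omega1 \<Rightarrow> stage) \<Rightarrow> omega1 \<Rightarrow> (omega1 \<Rightarrow> nat) \<Rightarrow> bool"
  where "row_ok f \<alpha> g \<longleftrightarrow> (\<forall>y. g y < 2) \<and> (\<forall>x<\<alpha>. \<forall>\<^sub>F y in filt f x. g y = g x) \<and>
    ((\<forall>x<\<alpha>. \<forall>\<^sub>F y in filt f x. y \<notin> tail (E \<alpha>)) \<longrightarrow> g (E \<alpha> 0) = 0 \<and> (\<forall>y\<in>tail (E \<alpha>). g y = 1)) \<and>
    (\<forall>x<\<alpha>. ultra (filt f x) \<and> (\<exists>\<^sub>F y in filt f x. y \<in> range (E \<alpha>)) \<longrightarrow>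
      (\<forall>v<2. infinite {y \<in> range (E \<alpha>). g y = v}))"

text \<open>A new filter is created only for a range that all earlier filters avoid; this keeps the
  filters separated.\<close>

definition limit_stage :: "(omega1 \<Rightarrow> stage) \<Rightarrow> omega1 \<Rightarrow> bool"
  where "limit_stage f \<alpha> \<longleftrightarrow> \<alpha> \<in> S \<and> (\<forall>x<\<alpha>. \<forall>\<^sub>F y in filt f x. y \<notin> range (E \<alpha>))"

text \<open>The column of a limit stage consists of the limits of the rows up to
  \<open>\<alpha>\<close>, where row \<open>\<alpha>\<close> is the \<open>g\<close> chosen at the
  same stage. The guard \<open>y < \<alpha>\<close> restricts the condition to entries fixed
  earlier.\<close>

definition col_ok :: "(omega1 \<Rightarrow> stage) \<Rightarrow> omega1 \<Rightarrow> stage \<Rightarrow> bool"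
  where "col_ok f \<alpha> r \<longleftrightarrow> (case r of (g, c, \<F>) \<Rightarrow> (\<forall>\<beta>. c \<beta> < 3) \<and> p_filter \<F> \<and>
    (if limit_stage f \<alpha> then
      (\<forall>\<beta><\<alpha>. \<forall>\<^sub>F y in \<F>. y < \<alpha> \<longrightarrow> entry f \<beta> y = c \<beta>) \<and> (\<forall>\<^sub>F y in \<F>. g y = c \<alpha>) \<and>
      (\<forall>\<^sub>F y in \<F>. y \<in> range (E \<alpha>)) \<and> \<F> \<noteq> bot \<and> (\<alpha> \<in> U \<longrightarrow> ultra \<F>) \<and>
      (\<alpha> \<notin> U \<longrightarrow> (\<exists>T. \<F> = inf cofinite (principal T)))
    else \<F> = bot \<and> (\<forall>\<beta><\<alpha>. c \<beta> = Q \<alpha> \<beta>) \<and> c \<alpha> = 2))"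

definition stage_ok :: "(omega1 \<Rightarrow> stage) \<Rightarrow> omega1 \<Rightarrow> stage \<Rightarrow> bool"
  where "stage_ok f \<alpha> r \<longleftrightarrow> row_ok f \<alpha> (fst r) \<and> col_ok f \<alpha> r"

text \<open>The recursion principle demands that a stage depend on earlier stages only;
  \<open>entry\<close> complies when both indices are below \<open>\<alpha>\<close>.\<close>

lemma stage_ok_cong:
  assumes "\<And>x. x < \<alpha> \<Longrightarrow> f x = f' x"
  shows "stage_ok f \<alpha> r = stage_ok f' \<alpha> r"
proof -
  have 1: "(\<forall>x<\<alpha>. P (f x) x) = (\<forall>x<\<alpha>. P (f' x) x)" for P
    using assms by auto
  have 2: "row_ok f \<alpha> g = row_ok f' \<alpha> g" for g
    unfolding row_ok_def
    using 1[of "\<lambda>r x. \<forall>\<^sub>F y in snd (snd r). g y = g x"]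
      1[of "\<lambda>r x. \<forall>\<^sub>F y in snd (snd r). y \<notin> tail (E \<alpha>)"]
      1[of "\<lambda>r x. ultra (snd (snd r)) \<and> (\<exists>\<^sub>F y in snd (snd r). y \<in> range (E \<alpha>)) \<longrightarrow>
        (\<forall>v<2. infinite {y \<in> range (E \<alpha>). g y = v})"] by simp
  have 3: "limit_stage f \<alpha> = limit_stage f' \<alpha>"
    unfolding limit_stage_def
    using 1[of "\<lambda>r x. \<forall>\<^sub>F y in snd (snd r). y \<notin> range (E \<alpha>)"] by simp
  have "(y < \<alpha> \<longrightarrow> entry f \<beta> y = v) = (y < \<alpha> \<longrightarrow> entry f' \<beta> y = v)" if "\<beta> < \<alpha>" for \<beta> y v
    using assms that by (auto simp: entry_def)
  then have 4: "(\<forall>\<beta><\<alpha>. \<forall>\<^sub>F y in \<F>. y < \<alpha> \<longrightarrow> entry f \<beta> y = c \<beta>) =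
      (\<forall>\<beta><\<alpha>. \<forall>\<^sub>F y in \<F>. y < \<alpha> \<longrightarrow> entry f' \<beta> y = c \<beta>)" for \<F> c
    by simp
  show ?thesis
    unfolding stage_ok_def col_ok_def 2 3 4 ..
qed

lemma stage_ok_p_filter: "stage_ok f \<alpha> r \<Longrightarrow> p_filter (snd (snd r))"
  by (auto simp: stage_ok_def col_ok_def)

text \<open>The filter of a limit stage \<open>z\<close> contains the range of \<open>E z\<close>,
  which the earlier filters avoid. At any other stage it is \<open>bot\<close>.\<close>

lemma stages_separated:
  assumes "x < z" and "stage_ok f z (f z)"
  shows "\<exists>D. (\<forall>\<^sub>F y in filt f x. y \<in> D) \<and> (\<forall>\<^sub>F y in filt f z. y \<notin> D)"
proof (cases "limit_stage f z")
  case True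
  then show ?thesis
    using assms by (intro exI[of _ "- range (E z)"])
      (auto simp: limit_stage_def stage_ok_def col_ok_def split: prod.splits)
next
  case False
  then show ?thesis
    using assms(2) by (intro exI[of _ UNIV]) (auto simp: stage_ok_def col_ok_def split: prod.splits)
qed

text \<open>If an earlier ultrafilter meets the range, splitting provides the row; if all earlier
  filters avoid the tail, separation does. Otherwise both conditional demands are void and a
  constant row will do.\<close>

lemma row_exists:
  assumes ok: "\<And>x. x < \<alpha> \<Longrightarrow> stage_ok f x (f x)"
  shows "\<exists>g. row_ok f \<alpha> g"
proof -
  have pf: "p_filter (filt f x)" if "x \<in> {..<\<alpha>}" for x
    using stage_ok_p_filter[OF ok] that by simp
  have disj: "\<exists>D. (\<forall>\<^sub>F y in filt f x. y \<in> D) \<and> (\<forall>\<^sub>F y in filt f z. y \<notin> D)"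
    if "x \<in> {..<\<alpha>}" "z \<in> {..<\<alpha>}" "x \<noteq> z" for x z
  proof (cases "x < z")
    case True
    then show ?thesis
      using stages_separated ok that by simp
  next
    case False
    have "z < x"
      using False that by simp
    have "\<exists>D. (\<forall>\<^sub>F y in filt f z. y \<in> D) \<and> (\<forall>\<^sub>F y in filt f x. y \<notin> D)"
      by (rule stages_separated[OF \<open>z < x\<close> ok]) (use that in simp)
    then obtain D where "\<forall>\<^sub>F y in filt f z. y \<in> D" "\<forall>\<^sub>F y in filt f x. y \<notin> D"
      by blast
    then show ?thesis
      by (intro exI[of _ "- D"]) simp
  qed
  have tail_range: "(\<forall>\<^sub>F y in filt f x. y \<notin> range (E \<alpha>))"
    if x: "x < \<alpha>" and ev: "\<forall>\<^sub>F y in filt f x. y \<notin> tail (E \<alpha>)" for x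
  proof -
    have "\<forall>\<^sub>F y in filt f x. y \<notin> {E \<alpha> 0}"
      using x by (intro p_filter_finite pf) auto
    with ev show ?thesis
      by eventually_elim (simp add: range_eq_insert_tail)
  qed
  consider (split) x where "x < \<alpha>" "ultra (filt f x)" "\<exists>\<^sub>F y in filt f x. y \<in> range (E \<alpha>)"
    | (separate) "\<And>x. x < \<alpha> \<Longrightarrow> \<not> (ultra (filt f x) \<and> (\<exists>\<^sub>F y in filt f x. y \<in> range (E \<alpha>)))"
      "\<And>x. x < \<alpha> \<Longrightarrow> \<forall>\<^sub>F y in filt f x. y \<notin> tail (E \<alpha>)"
    | (none) x where "\<And>x. x < \<alpha> \<Longrightarrow> \<not> (ultra (filt f x) \<and> (\<exists>\<^sub>F y in filt f x. y \<in> range (E \<alpha>)))"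
      "x < \<alpha>" "\<not> (\<forall>\<^sub>F y in filt f x. y \<notin> tail (E \<alpha>))"
    by metis
  then show ?thesis
  proof cases
    case split
    have "x \<in> {..<\<alpha>}"
      using split by simp
    from p_filters_continuous_splitting[where F = "filt f",
        OF countable_lessThan_omega1 pf disj this split(2,3)]
    obtain g :: "omega1 \<Rightarrow> nat" where "\<And>y. g y < 2"
      "\<And>z. z \<in> {..<\<alpha>} \<Longrightarrow> \<forall>\<^sub>F y in filt f z. g y = g z"
      "\<And>v. v < 2 \<Longrightarrow> infinite {y \<in> range (E \<alpha>). g y = v}"
      by blast
    moreover have "\<not> (\<forall>x<\<alpha>. \<forall>\<^sub>F y in filt f x. y \<notin> tail (E \<alpha>))"
      using tail_range split by (auto simp: frequently_def)
    ultimately have "row_ok f \<alpha> g"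
      by (simp add: row_ok_def del: not_all)
    then show ?thesis
      by blast
  next
    case separate
    have "\<forall>\<^sub>F y in filt f x. y \<notin> tail (E \<alpha>)" if "x \<in> {..<\<alpha>}" for x
      using separate(2) that by simp
    from p_filters_continuous_separation[where F = "filt f" and c = "E \<alpha> 0",
        OF countable_lessThan_omega1 pf disj this]
    obtain g :: "omega1 \<Rightarrow> nat" where "\<And>y. g y < 2"
      "\<And>z. z \<in> {..<\<alpha>} \<Longrightarrow> \<forall>\<^sub>F y in filt f z. g y = g z"
      "\<And>y. y \<in> tail (E \<alpha>) \<Longrightarrow> g y = 1" "g (E \<alpha> 0) = 0"
      by (auto simp: tail_def)
    then have "row_ok f \<alpha> g"
      using separate(1) by (simp add: row_ok_def) blast
    then show ?thesis
      by blast
  next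
    case none
    then have "row_ok f \<alpha> (\<lambda>_. 0)"
      unfolding row_ok_def by auto
    then show ?thesis
      by blast
  qed
qed

text \<open>At a limit stage the entries along \<open>E \<alpha>\<close> have limits along the
  P-point \<open>p\<close>. The image of \<open>p\<close> is the required ultrafilter; the P-point
  property yields a genuinely convergent subsequence when a cofinite filter is wanted.\<close>

lemma stage_exists:
  fixes p :: "nat filter"
  assumes p: "p \<noteq> bot" "ultra p" "p_filter p"
    and inj: "\<alpha> \<in> S \<Longrightarrow> inj (E \<alpha>)" and Q: "\<And>\<beta>. Q \<alpha> \<beta> < 3"
    and ok: "\<And>x. x < \<alpha> \<Longrightarrow> stage_ok f x (f x)"
  shows "\<exists>r. stage_ok f \<alpha> r"
proof -
  obtain g where g: "row_ok f \<alpha> g"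
    using row_exists[OF ok] by blast
  show ?thesis
  proof (cases "limit_stage f \<alpha>")
    case False
    then have "stage_ok f \<alpha> (g, (Q \<alpha>)(\<alpha> := 2), bot)"
      using g Q by (auto simp: stage_ok_def col_ok_def)
    then show ?thesis
      by blast
  next
    case True
    then have inj: "inj (E \<alpha>)"
      using inj by (simp add: limit_stage_def)
    \<comment> \<open>The rows up to \<open>\<alpha>\<close>, including the new row
      \<open>g\<close>, made total by the default 0 so that all limits exist.\<close>
    define h where "h \<beta> y = (if \<beta> = \<alpha> then g y else if y < \<alpha> \<and> \<beta> < \<alpha> then entry f \<beta> y else 0)" for \<beta> y
    have g2: "g y < 2" for y
      using g by (simp add: row_ok_def)
    have fst2: "fst (f \<beta>) y < 2" and snd3: "fst (snd (f y)) \<beta> < 3" if "\<beta> < \<alpha>" "y < \<alpha>" for \<beta> y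
      using ok[OF that(1)] ok[OF that(2)]
      by (auto simp: stage_ok_def row_ok_def col_ok_def split: prod.splits)
    have fst3: "fst (f \<beta>) y < 3" if "\<beta> < \<alpha>" "y < \<alpha>" for \<beta> y
      using fst2[OF that] by simp
    have "h \<beta> y < 3" for \<beta> y
      using g2[of y] snd3 fst3 by (simp add: h_def entry_def)
    then have "\<exists>v<3. \<forall>\<^sub>F k in p. h \<beta> (E \<alpha> k) = v" for \<beta>
      by (intro ultra_limit_exists[OF p(2)])
    then obtain c where c: "\<And>\<beta>. c \<beta> < 3" "\<And>\<beta>. \<forall>\<^sub>F k in p. h \<beta> (E \<alpha> k) = c \<beta>"
      by metis
    have stage: "stage_ok f \<alpha> (g, c, \<F>)"
      if \<F>: "\<And>\<beta>. \<beta> \<le> \<alpha> \<Longrightarrow> \<forall>\<^sub>F y in \<F>. h \<beta> y = c \<beta>" "\<forall>\<^sub>F y in \<F>. y \<in> range (E \<alpha>)"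
        "\<F> \<noteq> bot" "p_filter \<F>" "\<alpha> \<in> U \<longrightarrow> ultra \<F>" "\<alpha> \<notin> U \<longrightarrow> (\<exists>T. \<F> = inf cofinite (principal T))"
      for \<F>
    proof -
      have "\<forall>\<^sub>F y in \<F>. y < \<alpha> \<longrightarrow> entry f \<beta> y = c \<beta>" if "\<beta> < \<alpha>" for \<beta>
        using \<F>(1)[OF less_imp_le[OF that]] by eventually_elim (use that in \<open>auto simp: h_def split: if_splits\<close>)
      moreover have "\<forall>\<^sub>F y in \<F>. g y = c \<alpha>"
        using \<F>(1)[of \<alpha>] by (simp add: h_def)
      ultimately show ?thesis
        using \<F> True c(1) g by (simp add: stage_ok_def col_ok_def)
    qed
    have "\<exists>\<F>. (\<forall>\<beta>\<le>\<alpha>. \<forall>\<^sub>F y in \<F>. h \<beta> y = c \<beta>) \<and> (\<forall>\<^sub>F y in \<F>. y \<in> range (E \<alpha>)) \<and>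
        \<F> \<noteq> bot \<and> p_filter \<F> \<and> (\<alpha> \<in> U \<longrightarrow> ultra \<F>) \<and> (\<alpha> \<notin> U \<longrightarrow> (\<exists>T. \<F> = inf cofinite (principal T)))"
    proof (cases "\<alpha> \<in> U")
      case True
      then show ?thesis
        using p inj c(2)
        by (intro exI[of _ "filtermap (E \<alpha>) p"])
          (auto simp: eventually_filtermap filtermap_bot_iff ultra_filtermap p_filter_filtermap_inj)
    next
      case False
      \<comment> \<open>Only countably many rows exist so far, hence one member \<open>B\<close> of
        \<open>p\<close> is almost contained in every \<open>D \<beta>\<close>, and all these rows
        converge along \<open>E \<alpha>\<close> on \<open>B\<close>.\<close>
      define D where "D \<beta> = {k. h \<beta> (E \<alpha> k) = c \<beta>}" for \<beta>
      have "\<forall>\<^sub>F k in p. k \<in> D \<beta>" for \<beta>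
        using c(2) by (simp add: D_def)
      then have "\<exists>B. (\<forall>\<^sub>F k in p. k \<in> B) \<and> (\<forall>\<beta>\<in>{..\<alpha>}. finite (B - D \<beta>))"
        by (intro p_filter_pseudo_intersection[OF p(3) countable_atMost_omega1])
      then obtain B where B: "\<forall>\<^sub>F k in p. k \<in> B" "\<And>\<beta>. \<beta> \<le> \<alpha> \<Longrightarrow> finite (B - D \<beta>)"
        by auto
      have "infinite B"
        using B(1) p(1) by (intro p_filter_frequently_infinite[OF p(3)] eventually_frequently)
      then have "infinite (E \<alpha> ` B)"
        using inj by (metis finite_imageD inj_on_subset subset_UNIV)
      moreover have "finite {y \<in> E \<alpha> ` B. h \<beta> y \<noteq> c \<beta>}" if "\<beta> \<le> \<alpha>" for \<beta>
        by (rule finite_subset[OF _ finite_imageI[OF B(2)[OF that], of "E \<alpha>"]]) (auto simp: D_def)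
      moreover have "finite {y \<in> E \<alpha> ` B. y \<notin> range (E \<alpha>)}"
        by (rule finite_subset[of _ "{}"]) auto
      ultimately show ?thesis
        using False
        by (intro exI[of _ "inf cofinite (principal (E \<alpha> ` B))"])
          (auto simp: eventually_cofinite_on trivial_limit_def p_filter_cofinite_on)
    qed
    then obtain \<F> where "\<forall>\<beta>\<le>\<alpha>. \<forall>\<^sub>F y in \<F>. h \<beta> y = c \<beta>" "\<forall>\<^sub>F y in \<F>. y \<in> range (E \<alpha>)"
      "\<F> \<noteq> bot" "p_filter \<F>" "\<alpha> \<in> U \<longrightarrow> ultra \<F>" "\<alpha> \<notin> U \<longrightarrow> (\<exists>T. \<F> = inf cofinite (principal T))"
      by blast
    then have "stage_ok f \<alpha> (g, c, \<F>)"
      by (intro stage) simp_all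
    then show ?thesis
      by blast
  qed
qed

text \<open>The last three properties yield, in this order, cluster points, the Hausdorff property together
  with closed discrete sets, and the divergence of sequences.\<close>

lemma matrix_exists:
  fixes p :: "nat filter"
  assumes p: "p \<noteq> bot" "ultra p" "p_filter p"
    and E: "\<And>\<alpha>. \<alpha> \<in> S \<Longrightarrow> inj (E \<alpha>)" "\<And>\<alpha>. \<alpha> \<in> S \<Longrightarrow> range (E \<alpha>) \<subseteq> {..<\<alpha>}"
    and Q: "\<And>\<alpha> \<beta>. Q \<alpha> \<beta> < 3"
  obtains G :: "omega1 \<Rightarrow> omega1 \<Rightarrow> nat" and F :: "omega1 \<Rightarrow> omega1 filter"
  where "\<And>\<beta> x. G \<beta> x < 3" and "\<And>\<alpha> x. x < \<alpha> \<Longrightarrow> G \<alpha> x < 2"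
    and "\<And>\<alpha> \<beta>. \<alpha> \<notin> S \<Longrightarrow> \<beta> < \<alpha> \<Longrightarrow> G \<beta> \<alpha> = Q \<alpha> \<beta>" "\<And>\<alpha>. \<alpha> \<notin> S \<Longrightarrow> G \<alpha> \<alpha> = 2"
    and "\<And>x. p_filter (F x)" and "\<And>\<beta> x. \<forall>\<^sub>F y in F x. G \<beta> y = G \<beta> x"
    and "\<And>x. F x \<noteq> bot \<Longrightarrow> x \<in> S" and "\<And>x. \<forall>\<^sub>F y in F x. y \<in> range (E x)"
    and "\<And>x. x \<in> U \<Longrightarrow> ultra (F x)" and "\<And>x. x \<notin> U \<Longrightarrow> \<exists>T. F x = inf cofinite (principal T)"
    and "\<And>\<alpha>. \<alpha> \<in> S \<Longrightarrow> \<exists>x\<le>\<alpha>. \<exists>\<^sub>F y in F x. y \<in> range (E \<alpha>)"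
    and "\<And>\<alpha>. range (E \<alpha>) \<subseteq> {..<\<alpha>} \<Longrightarrow> (\<And>x. x < \<alpha> \<Longrightarrow> \<forall>\<^sub>F y in F x. y \<notin> tail (E \<alpha>)) \<Longrightarrow>
      G \<alpha> (E \<alpha> 0) = 0 \<and> (\<forall>y\<in>tail (E \<alpha>). G \<alpha> y = 1)"
    and "\<And>\<alpha> x v. range (E \<alpha>) \<subseteq> {..<\<alpha>} \<Longrightarrow> x < \<alpha> \<Longrightarrow> ultra (F x) \<Longrightarrow>
      \<exists>\<^sub>F y in F x. y \<in> range (E \<alpha>) \<Longrightarrow> v < 2 \<Longrightarrow> infinite {y \<in> range (E \<alpha>). G \<alpha> y = v}"
proof -
  have "\<exists>f. \<forall>\<alpha>. stage_ok f \<alpha> (f \<alpha>)"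
  proof (rule dependent_wellorder_choice)
    show "stage_ok f \<alpha> r = stage_ok f' \<alpha> r" if "\<And>x. x < \<alpha> \<Longrightarrow> f x = f' x" for f f' \<alpha> r
      by (rule stage_ok_cong[OF that])
    show "\<exists>r. stage_ok f \<alpha> r" if "\<And>x. x < \<alpha> \<Longrightarrow> stage_ok f x (f x)" for f \<alpha>
      by (rule stage_exists[OF p E(1) Q that])
  qed
  then obtain f where f: "\<And>\<alpha>. stage_ok f \<alpha> (f \<alpha>)"
    by blast
  have row: "row_ok f \<alpha> (fst (f \<alpha>))" and col: "col_ok f \<alpha> (f \<alpha>)" for \<alpha>
    using f by (auto simp: stage_ok_def)
  define G where "G = entry f"
  define F where "F = filt f"
  \<comment> \<open>The filter of a limit stage lives below \<open>\<alpha>\<close>, which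
    discharges the guard in \<open>col_ok\<close>.\<close>
  have lim: "\<alpha> \<in> S" "\<forall>\<^sub>F y in F \<alpha>. y < \<alpha>" if "limit_stage f \<alpha>" for \<alpha>
  proof -
    show "\<alpha> \<in> S"
      using that by (simp add: limit_stage_def)
    then have "y \<in> range (E \<alpha>) \<Longrightarrow> y < \<alpha>" for y
      using E(2) by blast
    moreover have "\<forall>\<^sub>F y in F \<alpha>. y \<in> range (E \<alpha>)"
      using col[of \<alpha>] that by (auto simp: col_ok_def F_def split: prod.splits)
    ultimately show "\<forall>\<^sub>F y in F \<alpha>. y < \<alpha>"
      using eventually_mono by force
  qed
  have bot: "F \<alpha> = bot" if "\<not> limit_stage f \<alpha>" for \<alpha>
    using col[of \<alpha>] that by (auto simp: col_ok_def F_def split: prod.splits)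
  have Grow: "G \<alpha> x = fst (f \<alpha>) x" if "x < \<alpha>" for \<alpha> x
    using that by (simp add: G_def entry_def)
  show thesis
  proof (rule that[of G F])
    show G2: "G \<alpha> x < 2" if "x < \<alpha>" for \<alpha> x
      using row[of \<alpha>] Grow[OF that] by (simp add: row_ok_def)
    show "G \<beta> x < 3" for \<beta> x
    proof (cases "x < \<beta>")
      case True
      then show ?thesis
        using G2[OF True] by simp
    next
      case False
      then show ?thesis
        using col[of x] by (auto simp: G_def entry_def col_ok_def split: prod.splits)
    qed
    show "G \<beta> \<alpha> = Q \<alpha> \<beta>" if "\<alpha> \<notin> S" "\<beta> < \<alpha>" for \<alpha> \<beta>
      using col[of \<alpha>] that
      by (auto simp: G_def entry_def col_ok_def limit_stage_def split: prod.splits)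
    show "G \<alpha> \<alpha> = 2" if "\<alpha> \<notin> S" for \<alpha>
      using col[of \<alpha>] that
      by (auto simp: G_def entry_def col_ok_def limit_stage_def split: prod.splits)
    show "p_filter (F x)" for x
      using f[of x] by (simp add: F_def stage_ok_p_filter)
    show "F x \<noteq> bot \<Longrightarrow> x \<in> S" for x
      using bot lim by blast
    show "\<forall>\<^sub>F y in F x. y \<in> range (E x)" for x
      using col[of x] by (auto simp: F_def col_ok_def split: prod.splits if_splits)
    show "ultra (F x)" if "x \<in> U" for x
      using col[of x] that
      by (auto simp: F_def col_ok_def ultra_def split: prod.splits if_splits)
    show "\<exists>T. F x = inf cofinite (principal T)" if "x \<notin> U" for x
      using col[of x] that bot[of x] bot_eq_cofinite_on
      by (cases "limit_stage f x") (auto simp: F_def col_ok_def split: prod.splits)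
    show "\<forall>\<^sub>F y in F x. G \<beta> y = G \<beta> x" for \<beta> x
    proof (cases "limit_stage f x")
      case False
      then show ?thesis
        by (simp add: bot)
    next
      case True
      have Gcol: "G \<beta> x = fst (snd (f x)) \<beta>" if "\<beta> \<le> x"
        using that by (auto simp: G_def entry_def)
      \<comment> \<open>Earlier rows and the row of \<open>x\<close> converge by the choice of the
        column of \<open>x\<close>; later rows were chosen to respect the filter of
        \<open>x\<close>.\<close>
      consider "\<beta> < x" | "\<beta> = x" | "x < \<beta>"
        by fastforce
      then show ?thesis
      proof cases
        case 1
        then have "\<forall>\<^sub>F y in F x. y < x \<longrightarrow> entry f \<beta> y = fst (snd (f x)) \<beta>"
          using col[of x] True by (auto simp: F_def col_ok_def split: prod.splits)
        with lim(2)[OF True] show ?thesis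
          by eventually_elim (use 1 Gcol in \<open>simp add: G_def\<close>)
      next
        case 2
        then have "\<forall>\<^sub>F y in F x. fst (f x) y = fst (snd (f x)) \<beta>"
          using col[of x] True by (auto simp: F_def col_ok_def split: prod.splits)
        with lim(2)[OF True] show ?thesis
          by eventually_elim (use 2 Gcol Grow in simp)
      next
        case 3
        then have "\<forall>\<^sub>F y in F x. fst (f \<beta>) y = fst (f \<beta>) x"
          using row[of \<beta>] by (simp add: F_def row_ok_def)
        with lim(2)[OF True] show ?thesis
          by eventually_elim (use 3 Grow in auto)
      qed
    qed
    show "\<exists>x\<le>\<alpha>. \<exists>\<^sub>F y in F x. y \<in> range (E \<alpha>)" if "\<alpha> \<in> S" for \<alpha>
    proof (cases "limit_stage f \<alpha>")
      case True
      then have "\<forall>\<^sub>F y in F \<alpha>. y \<in> range (E \<alpha>)" "F \<alpha> \<noteq> bot"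
        using col[of \<alpha>] by (auto simp: F_def col_ok_def split: prod.splits)
      then show ?thesis
        using eventually_frequently by blast
    next
      \<comment> \<open>A stage of \<open>S\<close> fails to be a limit stage only if an earlier
        filter already meets the range.\<close>
      case False
      then show ?thesis
        using that by (auto simp: limit_stage_def F_def frequently_def intro: less_imp_le)
    qed
    show "G \<alpha> (E \<alpha> 0) = 0 \<and> (\<forall>y\<in>tail (E \<alpha>). G \<alpha> y = 1)"
      if R: "range (E \<alpha>) \<subseteq> {..<\<alpha>}" and sm: "\<And>x. x < \<alpha> \<Longrightarrow> \<forall>\<^sub>F y in F x. y \<notin> tail (E \<alpha>)" for \<alpha>
    proof -
      have "y < \<alpha>" if "y = E \<alpha> 0 \<or> y \<in> tail (E \<alpha>)" for y
        using R that by (auto simp: tail_def)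
      moreover have "fst (f \<alpha>) (E \<alpha> 0) = 0 \<and> (\<forall>y\<in>tail (E \<alpha>). fst (f \<alpha>) y = 1)"
        using row[of \<alpha>] sm by (simp add: F_def row_ok_def)
      ultimately show ?thesis
        by (simp add: Grow)
    qed
    show "infinite {y \<in> range (E \<alpha>). G \<alpha> y = v}"
      if "range (E \<alpha>) \<subseteq> {..<\<alpha>}" "x < \<alpha>" "ultra (F x)" "\<exists>\<^sub>F y in F x. y \<in> range (E \<alpha>)" "v < 2"
      for \<alpha> x v
    proof -
      have "infinite {y \<in> range (E \<alpha>). fst (f \<alpha>) y = v}"
        using row[of \<alpha>] that by (auto simp: F_def row_ok_def)
      moreover have "{y \<in> range (E \<alpha>). fst (f \<alpha>) y = v} = {y \<in> range (E \<alpha>). G \<alpha> y = v}"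
        using that(1) Grow by auto
      ultimately show ?thesis
        by simp
    qed
  qed
qed

end

section \<open>Layered systems\<close>

definition transversal :: "('a \<Rightarrow> nat \<times> nat) \<Rightarrow> nat \<Rightarrow> 'a set \<Rightarrow> bool"
  where "transversal L i A \<longleftrightarrow> countable A \<and> infinite A \<and> (\<forall>z\<in>A. fst (L z) = i) \<and>
    (\<forall>m. finite {z \<in> A. L z = (i, m)})"

definition on_level :: "('a \<Rightarrow> nat \<times> nat) \<Rightarrow> nat \<Rightarrow> 'a set \<Rightarrow> bool"
  where "on_level L i A \<longleftrightarrow> countable A \<and> infinite A \<and> (\<exists>m. \<forall>z\<in>A. L z = (i, m))"

text \<open>The sets that get cluster points but no convergent subsequences.\<close>

definition clustering :: "('a \<Rightarrow> nat \<times> nat) \<Rightarrow> nat \<Rightarrow> 'a set \<Rightarrow> bool"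
  where "clustering L i A \<longleftrightarrow> i = 1 \<and> on_level L i A \<or> i = 2 \<and> transversal L i A"

text \<open>A point \<open>x\<close> has the coordinates \<open>G \<beta> x\<close>; its level \<open>L x = (i, m)\<close> places it in the \<open>m\<close>-th layer of the
  \<open>i\<close>-th of the three subspaces, where \<open>i = 0, 1, 2\<close> stand for \<open>Z\<^sub>1, Z\<^sub>2, Z\<^sub>3\<close>.\<close>

locale layered_system =
  fixes G :: "'b \<Rightarrow> 'a \<Rightarrow> nat" and L :: "'a \<Rightarrow> nat \<times> nat"
  assumes dense: "countable D \<Longrightarrow> finite P \<Longrightarrow>
      \<exists>y \<beta>. L y = l \<and> (\<forall>b\<in>P. G b y = G b x) \<and> (\<forall>z\<in>D. G \<beta> z \<noteq> G \<beta> y)"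
    and separated: "x \<noteq> y \<Longrightarrow> \<exists>\<beta>. G \<beta> x \<noteq> G \<beta> y"
    and discrete: "on_level L i A \<Longrightarrow> i = 0 \<or> i = 2 \<Longrightarrow> \<exists>\<beta>. \<forall>z\<in>A - {y}. G \<beta> z \<noteq> G \<beta> y"
    and convergent: "transversal L i A \<Longrightarrow> i < 2 \<Longrightarrow>
      \<exists>T\<subseteq>A. infinite T \<and> (\<exists>y. fst (L y) = i \<and> (\<forall>\<beta>. finite {z \<in> T. G \<beta> z \<noteq> G \<beta> y}))"
    and cluster: "clustering L i A \<Longrightarrow>
      \<exists>y. fst (L y) = i \<and> (\<forall>P. finite P \<longrightarrow> infinite {z \<in> A. \<forall>b\<in>P. G b z = G b y})"
    and divergent: "clustering L i A \<Longrightarrow>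
      \<exists>\<beta> v w. v \<noteq> w \<and> infinite {z \<in> A. G \<beta> z = v} \<and> infinite {z \<in> A. G \<beta> z = w}"

text \<open>Every countable set that calls for a limit is enumerated at some stage, so some filter
  meets it frequently. Within one space a set on one level and a transversal set share only finitely
  many points, so that filter was created for a set of the same kind.\<close>

lemma layered_system_omega1:
  assumes CH: Continuum_Hypothesis
  shows "\<exists>(G :: omega1 \<Rightarrow> omega1 \<Rightarrow> nat) L. layered_system G L"
proof -
  obtain p :: "nat filter" where p: "p \<noteq> bot" "ultra p" "p_filter p"
    using p_point_CH[OF CH] .
  show ?thesis
  proof (rule omega1_tasks_CH[OF CH])
    fix Q :: "omega1 \<Rightarrow> omega1 \<Rightarrow> nat" and E :: "omega1 \<Rightarrow> nat \<Rightarrow> omega1" and L :: "omega1 \<Rightarrow> nat \<times> nat"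
    assume Q: "\<And>\<alpha> \<beta>. Q \<alpha> \<beta> < 3"
      and task: "\<And>e P q l D. countable P \<Longrightarrow> (\<And>\<beta>. q \<beta> < 3) \<Longrightarrow> countable D \<Longrightarrow>
        \<exists>\<alpha>. E \<alpha> = e \<and> (\<forall>\<beta>\<in>P. Q \<alpha> \<beta> = q \<beta>) \<and> L \<alpha> = l \<and> (\<forall>x\<in>D. x < \<alpha>)"
    have task': "\<exists>\<alpha>. E \<alpha> = e \<and> L \<alpha> = l \<and> range e \<subseteq> {..<\<alpha>} \<and> (\<forall>x\<in>D. x < \<alpha>)"
      if "countable D" for e l D
      using task[of "{}" "\<lambda>_. 0" "D \<union> range e" e l] that by auto
    \<comment> \<open>The sets that call for a limit: transversal sets of the first two spaces for a
      convergent sequence, clustering sets for an ultrafilter.\<close>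
    define admissible where "admissible i A \<longleftrightarrow> i < 2 \<and> transversal L i A \<or> clustering L i A" for i A
    define S where "S = {\<alpha>. inj (E \<alpha>) \<and> range (E \<alpha>) \<subseteq> {..<\<alpha>} \<and> admissible (fst (L \<alpha>)) (range (E \<alpha>))}"
    \<comment> \<open>A limit point lies in the same space as the set it was created for, so filters
      belonging to other spaces avoid that set.\<close>
    have tag: "fst (L z) = fst (L x)" if "x \<in> S" "z \<in> range (E x)" for x z
      using that by (auto simp: S_def admissible_def transversal_def clustering_def on_level_def)
    define U where "U = {\<alpha> \<in> S. clustering L (fst (L \<alpha>)) (range (E \<alpha>))}"
    have E: "\<And>\<alpha>. \<alpha> \<in> S \<Longrightarrow> inj (E \<alpha>)" "\<And>\<alpha>. \<alpha> \<in> S \<Longrightarrow> range (E \<alpha>) \<subseteq> {..<\<alpha>}"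
      by (auto simp: S_def)
    show ?thesis
    proof (rule matrix_exists[of p S E Q U, OF p E Q])
      fix G F
      assume G3: "\<And>\<beta> x. G \<beta> x < 3" and G2: "\<And>\<alpha> x. x < \<alpha> \<Longrightarrow> G \<alpha> x < 2"
        and G_gen: "\<And>\<alpha> \<beta>. \<alpha> \<notin> S \<Longrightarrow> \<beta> < \<alpha> \<Longrightarrow> G \<beta> \<alpha> = Q \<alpha> \<beta>" "\<And>\<alpha>. \<alpha> \<notin> S \<Longrightarrow> G \<alpha> \<alpha> = 2"
        and F: "\<And>x. p_filter (F x)" and GF: "\<And>\<beta> x. \<forall>\<^sub>F y in F x. G \<beta> y = G \<beta> x"
        and FS: "\<And>x. F x \<noteq> bot \<Longrightarrow> x \<in> S" and F_range: "\<And>x. \<forall>\<^sub>F y in F x. y \<in> range (E x)"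
        and F_U: "\<And>x. x \<in> U \<Longrightarrow> ultra (F x)"
        and F_not_U: "\<And>x. x \<notin> U \<Longrightarrow> \<exists>T. F x = inf cofinite (principal T)"
        and F_cluster: "\<And>\<alpha>. \<alpha> \<in> S \<Longrightarrow> \<exists>x\<le>\<alpha>. \<exists>\<^sub>F y in F x. y \<in> range (E \<alpha>)"
        and G_sep: "\<And>\<alpha>. range (E \<alpha>) \<subseteq> {..<\<alpha>} \<Longrightarrow> (\<And>x. x < \<alpha> \<Longrightarrow> \<forall>\<^sub>F y in F x. y \<notin> tail (E \<alpha>)) \<Longrightarrow>
          G \<alpha> (E \<alpha> 0) = 0 \<and> (\<forall>y\<in>tail (E \<alpha>). G \<alpha> y = 1)"
        and G_split: "\<And>\<alpha> x v. range (E \<alpha>) \<subseteq> {..<\<alpha>} \<Longrightarrow> x < \<alpha> \<Longrightarrow> ultra (F x) \<Longrightarrow>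
          \<exists>\<^sub>F y in F x. y \<in> range (E \<alpha>) \<Longrightarrow> v < 2 \<Longrightarrow> infinite {y \<in> range (E \<alpha>). G \<alpha> y = v}"

      \<comment> \<open>The pair of \<open>y\<close> and \<open>A\<close> is coded by a sequence
        that recurs at a stage above its range, where the row has to separate them.\<close>
      have separate: "\<exists>\<beta>. G \<beta> y = 0 \<and> (\<forall>z\<in>A. G \<beta> z = 1)"
        if A: "countable A" "y \<notin> A" and small: "\<And>x. \<forall>\<^sub>F z in F x. z \<notin> A" for A y
      proof -
        obtain e where e: "e 0 = y" "tail e = A"
          using tail_exists[OF A] by metis
        obtain \<alpha> where "E \<alpha> = e" "range e \<subseteq> {..<\<alpha>}"
          using task'[of "{}" e undefined] by auto
        then show ?thesis
          using G_sep[of \<alpha>] small e by auto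
      qed

      \<comment> \<open>The limit \<open>x\<close> may be older than the stage enumerating
        \<open>A\<close>; it is in the right space because \<open>A\<close> and the range of
        \<open>E x\<close> have a common point.\<close>
      have point: "\<exists>x. fst (L x) = i \<and> (\<exists>\<^sub>F y in F x. y \<in> A) \<and> infinite (A \<inter> range (E x)) \<and>
          admissible i (range (E x)) \<and> (x \<in> U \<longleftrightarrow> clustering L i (range (E x)))"
        if A: "admissible i A" for i A
      proof -
        have cA: "countable A" "infinite A" and tagA: "\<And>z. z \<in> A \<Longrightarrow> fst (L z) = i"
          using A by (auto simp: admissible_def transversal_def clustering_def on_level_def)
        have "bij_betw (from_nat_into A) UNIV A"
          by (rule bij_betw_from_nat_into[OF cA])
        then have e: "inj (from_nat_into A)" "range (from_nat_into A) = A"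
          by (auto simp: bij_betw_def)
        obtain \<alpha> where \<alpha>: "E \<alpha> = from_nat_into A" "L \<alpha> = (i, 0)" "A \<subseteq> {..<\<alpha>}"
          using task'[of "{}" "from_nat_into A" "(i, 0)"] e(2) by auto
        then have "\<alpha> \<in> S"
          using A e by (simp add: S_def)
        then obtain x where x: "\<exists>\<^sub>F y in F x. y \<in> A"
          using F_cluster[of \<alpha>] \<alpha>(1) e(2) by auto
        then have "F x \<noteq> bot"
          by (auto simp: frequently_def)
        then have xS: "x \<in> S"
          by (rule FS)
        have "\<exists>\<^sub>F y in F x. y \<in> A \<inter> range (E x)"
          using frequently_eventually_conj[OF x F_range] by (simp add: conj_commute)
        then have inf: "infinite (A \<inter> range (E x))"
          by (rule p_filter_frequently_infinite[OF F])
        then obtain z where z: "z \<in> A" "z \<in> range (E x)"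
          by (metis Int_iff finite.emptyI ex_in_conv)
        have "fst (L z) = fst (L x)"
          using tag[OF xS z(2)] .
        then have "fst (L x) = i"
          using tagA[OF z(1)] by simp
        then show ?thesis
          using x inf xS by (intro exI[of _ x]) (auto simp: S_def U_def)
      qed

      have ultra_point: "\<exists>x. fst (L x) = i \<and> (\<exists>\<^sub>F y in F x. y \<in> A) \<and> ultra (F x)"
        if A: "clustering L i A" for i A
      proof -
        obtain x where x: "fst (L x) = i" "\<exists>\<^sub>F y in F x. y \<in> A" "infinite (A \<inter> range (E x))"
          "admissible i (range (E x))" "x \<in> U \<longleftrightarrow> clustering L i (range (E x))"
          using point[of i A] A by (auto simp: admissible_def)
        have "clustering L i (range (E x))"
        proof (rule ccontr)
          assume "\<not> ?thesis"
          \<comment> \<open>This leaves only \<open>i = 1\<close>, with \<open>A\<close> on one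
            level and the range transversal, against their infinite intersection.\<close>
          then have tr: "i < 2" "transversal L i (range (E x))"
            using x(4) by (auto simp: admissible_def)
          then obtain m where m: "\<And>z. z \<in> A \<Longrightarrow> L z = (i, m)"
            using A by (auto simp: clustering_def on_level_def)
          have "A \<inter> range (E x) \<subseteq> {z \<in> range (E x). L z = (i, m)}"
            using m by blast
          moreover have "finite {z \<in> range (E x). L z = (i, m)}"
            using tr(2) unfolding transversal_def by blast
          ultimately show False
            using x(3) finite_subset by blast
        qed
        then show ?thesis
          using x F_U by blast
      qed

      have "layered_system G L"
      proof
        fix D P :: "omega1 set" and l x
        assume D: "countable D" and P: "finite P"
        \<comment> \<open>A constant sequence is not injective, so this stage lies outside
          \<open>S\<close>: its column is prescribed by \<open>Q\<close>, and row
          \<open>\<alpha>\<close> has 2 on the diagonal but smaller values at earlier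
          points.\<close>
        obtain \<alpha> where \<alpha>: "E \<alpha> = (\<lambda>_. x)" "\<And>\<beta>. \<beta> \<in> P \<Longrightarrow> Q \<alpha> \<beta> = G \<beta> x" "L \<alpha> = l"
          "\<And>z. z \<in> D \<union> P \<Longrightarrow> z < \<alpha>"
          using task[of P "\<lambda>\<beta>. G \<beta> x" "D \<union> P" "\<lambda>_. x" l] D P G3 by (auto simp: countable_finite)
        have "\<not> inj (\<lambda>_ :: nat. x)"
          by (auto simp: inj_def)
        then have "\<alpha> \<notin> S"
          using \<alpha>(1) by (auto simp: S_def)
        then have "\<forall>b\<in>P. G b \<alpha> = G b x" "G \<alpha> \<alpha> = 2"
          using G_gen \<alpha> by auto
        moreover have "G \<alpha> z \<noteq> 2" if "z \<in> D" for z
          using G2[of z \<alpha>] \<alpha>(4) that by force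
        ultimately show "\<exists>y \<beta>. L y = l \<and> (\<forall>b\<in>P. G b y = G b x) \<and> (\<forall>z\<in>D. G \<beta> z \<noteq> G \<beta> y)"
          using \<alpha>(3) by metis
      next
        fix x y :: omega1
        assume "x \<noteq> y"
        moreover have "\<forall>\<^sub>F z in F w. z \<notin> {x}" for w
          by (rule p_filter_finite[OF F]) simp
        ultimately obtain \<beta> where "G \<beta> y = 0" "G \<beta> x = 1"
          using separate[of "{x}" y] by auto
        then have "G \<beta> x \<noteq> G \<beta> y"
          by simp
        then show "\<exists>\<beta>. G \<beta> x \<noteq> G \<beta> y" ..
      next
        fix i and A :: "omega1 set" and y
        assume A: "on_level L i A" and i: "i = 0 \<or> i = 2"
        then obtain m where m: "\<And>z. z \<in> A \<Longrightarrow> L z = (i, m)" and cA: "countable A"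
          by (auto simp: on_level_def)
        \<comment> \<open>For \<open>i = 0\<close> or \<open>i = 2\<close> all limits within the
          space come from transversal sets, which meet a level in finite sets.\<close>
        have "\<forall>\<^sub>F z in F x. z \<notin> A - {y}" for x
        proof (cases "F x = bot")
          case False
          then have xS: "x \<in> S"
            by (rule FS)
          have "finite (A \<inter> range (E x))"
          proof (cases "fst (L x) = i")
            case True
            then have "transversal L i (range (E x))"
              using xS i by (auto simp: S_def admissible_def clustering_def)
            then have "finite {z \<in> range (E x). L z = (i, m)}"
              unfolding transversal_def by blast
            then show ?thesis
              by (rule rev_finite_subset) (use m in auto)
          next
            case False
            then have "A \<inter> range (E x) = {}"
              using tag[OF xS] m by fastforce
            then show ?thesis
              by simp
          qed
          then have "\<forall>\<^sub>F z in F x. z \<notin> A \<inter> range (E x)"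
            by (rule p_filter_finite[OF F])
          with F_range[of x] show ?thesis
            by eventually_elim auto
        qed simp
        then obtain \<beta> where "G \<beta> y = 0" "\<forall>z\<in>A - {y}. G \<beta> z = 1"
          using separate[of "A - {y}" y] cA by auto
        then show "\<exists>\<beta>. \<forall>z\<in>A - {y}. G \<beta> z \<noteq> G \<beta> y"
          by (metis zero_neq_one)
      next
        fix i and A :: "omega1 set"
        assume A: "transversal L i A" and i: "i < 2"
        obtain x where x: "fst (L x) = i" "\<exists>\<^sub>F y in F x. y \<in> A" "infinite (A \<inter> range (E x))"
          "admissible i (range (E x))" "x \<in> U \<longleftrightarrow> clustering L i (range (E x))"
          using point[of i A] A i by (auto simp: admissible_def)
        \<comment> \<open>With \<open>i < 2\<close> a clustering range lies on one level, which
          meets the transversal set \<open>A\<close> in a finite set only.\<close>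
        have "x \<notin> U"
        proof
          assume "x \<in> U"
          then obtain m where "\<And>z. z \<in> range (E x) \<Longrightarrow> L z = (i, m)"
            using x(5) i by (auto simp: clustering_def on_level_def)
          then have "A \<inter> range (E x) \<subseteq> {z \<in> A. L z = (i, m)}"
            by blast
          moreover have "finite {z \<in> A. L z = (i, m)}"
            using A unfolding transversal_def by blast
          ultimately show False
            using x(3) finite_subset by blast
        qed
        then obtain T where T: "F x = inf cofinite (principal T)"
          using F_not_U by blast
        have "\<forall>\<^sub>F y in F x. y \<in> T"
          by (simp add: T eventually_cofinite_on)
        from frequently_eventually_conj[OF x(2) this] have "\<exists>\<^sub>F y in F x. y \<in> A \<inter> T"
          by (simp add: conj_commute)
        then have "infinite (A \<inter> T)"
          by (rule p_filter_frequently_infinite[OF F])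
        moreover have "finite {z \<in> A \<inter> T. G \<beta> z \<noteq> G \<beta> x}" for \<beta>
          using GF[of \<beta> x] unfolding T eventually_cofinite_on
          by (rule rev_finite_subset) auto
        ultimately show "\<exists>T\<subseteq>A. infinite T \<and> (\<exists>y. fst (L y) = i \<and> (\<forall>\<beta>. finite {z \<in> T. G \<beta> z \<noteq> G \<beta> y}))"
          using x(1) by (intro exI[of _ "A \<inter> T"]) auto
      next
        fix i and A :: "omega1 set"
        assume "clustering L i A"
        then obtain x where x: "fst (L x) = i" "\<exists>\<^sub>F y in F x. y \<in> A"
          using ultra_point by blast
        have "infinite {z \<in> A. \<forall>b\<in>P. G b z = G b x}" if "finite P" for P
        proof -
          have "\<forall>\<^sub>F z in F x. \<forall>b\<in>P. G b z = G b x"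
            using that GF by (intro eventually_ball_finite) auto
          from frequently_eventually_conj[OF x(2) this]
          have "\<exists>\<^sub>F z in F x. z \<in> {z \<in> A. \<forall>b\<in>P. G b z = G b x}"
            by (simp add: conj_commute)
          then show ?thesis
            by (rule p_filter_frequently_infinite[OF F])
        qed
        then show "\<exists>y. fst (L y) = i \<and> (\<forall>P. finite P \<longrightarrow> infinite {z \<in> A. \<forall>b\<in>P. G b z = G b y})"
          using x(1) by blast
      next
        fix i and A :: "omega1 set"
        assume A: "clustering L i A"
        then obtain x where x: "\<exists>\<^sub>F y in F x. y \<in> A" "ultra (F x)"
          using ultra_point by blast
        have cA: "countable A" "A \<noteq> {}"
          using A by (auto simp: clustering_def transversal_def on_level_def)
        then have e: "range (from_nat_into A) = A"
          by (intro range_from_nat_into)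
        obtain \<alpha> where \<alpha>: "E \<alpha> = from_nat_into A" "A \<subseteq> {..<\<alpha>}" "x < \<alpha>"
          using task'[of "{x}" "from_nat_into A" undefined] e by auto
        then have "infinite {y \<in> A. G \<alpha> y = v}" if "v < 2" for v
          using G_split[of \<alpha> x v] x e that by simp
        then show "\<exists>\<beta> v w. v \<noteq> w \<and> infinite {z \<in> A. G \<beta> z = v} \<and> infinite {z \<in> A. G \<beta> z = w}"
          by (metis one_less_numeral_iff semiring_norm(76) zero_less_numeral zero_neq_one)
      qed
      then show ?thesis
        by blast
    qed
  qed
qed

text \<open>Moves the system from \<open>omega1\<close> to another point type. Injectivity preserves
  finiteness and countability, surjectivity pulls the witnesses back.\<close>

lemma layered_system_bij:
  fixes G :: "'b \<Rightarrow> 'a \<Rightarrow> nat" and h :: "'c \<Rightarrow> 'a"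
  assumes "layered_system G L" and h: "bij h"
  shows "layered_system (\<lambda>\<beta> a. G \<beta> (h a)) (\<lambda>a. L (h a))"
proof -
  interpret layered_system G L
    by fact
  have inj: "inj h" and surj: "surj h"
    using h by (auto simp: bij_def)
  have fin: "finite (h ` A) \<longleftrightarrow> finite A" and cnt: "countable (h ` A) \<longleftrightarrow> countable A" for A
    using inj by (auto simp: finite_image_iff inj_on_subset[OF inj] countable_image_inj_eq)
  have img: "h ` {a \<in> A. R (h a)} = {z \<in> h ` A. R z}" for A R
    by auto
  have inf: "infinite {z \<in> h ` A. R z} \<longleftrightarrow> infinite {a \<in> A. R (h a)}" for A R
    unfolding img[symmetric] fin ..
  have tr: "transversal (\<lambda>a. L (h a)) i A = transversal L i (h ` A)" for i A
    unfolding transversal_def fin cnt using inf[of A "\<lambda>z. L z = (i, _)"] by auto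
  have lev: "on_level (\<lambda>a. L (h a)) i A = on_level L i (h ` A)" for i A
    unfolding on_level_def fin cnt by auto
  have cl: "clustering (\<lambda>a. L (h a)) i A = clustering L i (h ` A)" for i A
    unfolding clustering_def tr lev ..
  show ?thesis
  proof
    fix D :: "'c set" and P :: "'b set" and l x
    assume "countable D" "finite P"
    then obtain y \<beta> where "L y = l" "\<forall>b\<in>P. G b y = G b (h x)" "\<forall>z\<in>h ` D. G \<beta> z \<noteq> G \<beta> y"
      using dense[of "h ` D" P l "h x"] by auto
    moreover obtain a where "y = h a"
      using surj by blast
    ultimately show "\<exists>y \<beta>. L (h y) = l \<and> (\<forall>b\<in>P. G b (h y) = G b (h x)) \<and> (\<forall>z\<in>D. G \<beta> (h z) \<noteq> G \<beta> (h y))"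
      by blast
  next
    show "x \<noteq> y \<Longrightarrow> \<exists>\<beta>. G \<beta> (h x) \<noteq> G \<beta> (h y)" for x y
      using separated inj by (metis injD)
  next
    show "\<exists>\<beta>. \<forall>z\<in>A - {y}. G \<beta> (h z) \<noteq> G \<beta> (h y)"
      if A: "on_level (\<lambda>a. L (h a)) i A" "i = 0 \<or> i = 2" for i A y
    proof -
      obtain \<beta> where "\<forall>z\<in>h ` A - {h y}. G \<beta> z \<noteq> G \<beta> (h y)"
        using discrete[of i "h ` A" "h y"] A unfolding lev by blast
      then have "\<forall>z\<in>A - {y}. G \<beta> (h z) \<noteq> G \<beta> (h y)"
        using inj by (auto dest: injD)
      then show ?thesis ..
    qed
  next
    fix i A
    assume "transversal (\<lambda>a. L (h a)) i A" "i < 2"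
    then obtain T y where T: "T \<subseteq> h ` A" "infinite T" "fst (L y) = i" "\<And>\<beta>. finite {z \<in> T. G \<beta> z \<noteq> G \<beta> y}"
      using convergent[of i "h ` A"] unfolding tr by auto
    obtain B where B: "B \<subseteq> A" "T = h ` B"
      using T(1) by (metis subset_image_iff)
    obtain a where a: "y = h a"
      using surj by blast
    have "finite {z \<in> B. G \<beta> (h z) \<noteq> G \<beta> (h a)}" for \<beta>
      using T(4)[of \<beta>] inf[of B "\<lambda>z. G \<beta> z \<noteq> G \<beta> (h a)"] by (simp add: B a)
    then show "\<exists>T\<subseteq>A. infinite T \<and> (\<exists>y. fst (L (h y)) = i \<and> (\<forall>\<beta>. finite {z \<in> T. G \<beta> (h z) \<noteq> G \<beta> (h y)}))"
      using B T(2,3) a fin by blast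
  next
    fix i A
    assume "clustering (\<lambda>a. L (h a)) i A"
    then obtain y where y: "fst (L y) = i" "\<And>P. finite P \<Longrightarrow> infinite {z \<in> h ` A. \<forall>b\<in>P. G b z = G b y}"
      using cluster[of i "h ` A"] unfolding cl by auto
    moreover obtain a where "y = h a"
      using surj by blast
    ultimately show "\<exists>y. fst (L (h y)) = i \<and> (\<forall>P. finite P \<longrightarrow> infinite {z \<in> A. \<forall>b\<in>P. G b (h z) = G b (h y)})"
      unfolding inf by blast
  next
    fix i A
    assume "clustering (\<lambda>a. L (h a)) i A"
    then show "\<exists>\<beta> v w. v \<noteq> w \<and> infinite {z \<in> A. G \<beta> (h z) = v} \<and> infinite {z \<in> A. G \<beta> (h z) = w}"
      using divergent[of i "h ` A"] unfolding cl inf by simp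
  qed
qed

section \<open>The topology\<close>

lemma dense_subset_of_iff:
  "dense_subset_of D Y \<longleftrightarrow> D \<subseteq> topspace Y \<and> (\<forall>U. openin Y U \<and> U \<noteq> {} \<longrightarrow> D \<inter> U \<noteq> {})"
  by (auto simp: dense_subset_of_def dense_intersects_open)

text \<open>An open set that meets \<open>K\<close> also meets its interior, since \<open>K\<close>
  is the closure of the latter; there the density of \<open>D\<close> applies.\<close>

lemma dense_subset_of_regular_closed:
  assumes D: "dense_subset_of D Y" and K: "regular_closed_in Y K"
  shows "dense_subset_of (D \<inter> Y interior_of K) (subtopology Y K)"
  unfolding dense_subset_of_iff
proof (intro conjI allI impI)
  show "D \<inter> Y interior_of K \<subseteq> topspace (subtopology Y K)"
    using D interior_of_subset[of Y K] by (auto simp: dense_subset_of_def)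
  fix U assume "openin (subtopology Y K) U \<and> U \<noteq> {}"
  then obtain V x where V: "openin Y V" "U = V \<inter> K" "x \<in> V" "x \<in> K"
    by (auto simp: openin_subtopology)
  have "x \<in> Y closure_of (Y interior_of K)"
    using K V(4) by (simp add: regular_closed_in_def)
  then have "V \<inter> Y interior_of K \<noteq> {}"
    using V(1,3) unfolding in_closure_of by blast
  moreover have "openin Y (V \<inter> Y interior_of K)"
    using V(1) by (intro openin_Int openin_interior_of)
  ultimately have "D \<inter> (V \<inter> Y interior_of K) \<noteq> {}"
    using D unfolding dense_subset_of_iff by blast
  then show "D \<inter> Y interior_of K \<inter> U \<noteq> {}"
    using V(2) interior_of_subset[of Y K] by blast
qed

lemma regular_closed_in_closedin: "regular_closed_in Y K \<Longrightarrow> closedin Y K"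
  unfolding regular_closed_in_def by (metis closedin_closure_of)

lemma accumulation_point_in_closed_subspace:
  assumes "closedin Y K" and "\<And>n. a n \<in> K" and x: "accumulation_point_of_seq Y a x"
  shows "accumulation_point_of_seq (subtopology Y K) a x"
proof -
  have "x \<in> K"
  proof (rule ccontr)
    assume "x \<notin> K"
    then have "openin Y (topspace Y - K)" "x \<in> topspace Y - K"
      using assms by (auto simp: accumulation_point_of_seq_def)
    then have "infinite {n. a n \<in> topspace Y - K}"
      using x unfolding accumulation_point_of_seq_def by blast
    then show False
      using assms(2) by simp
  qed
  then show ?thesis
    using x assms(2) unfolding accumulation_point_of_seq_def openin_subtopology by auto
qed

lemma convergent_subsequence_in_closed_subspace:
  assumes "closedin Y K" and "\<And>n. a n \<in> K" and "has_convergent_subsequence Y a"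
  shows "has_convergent_subsequence (subtopology Y K) a"
proof -
  obtain r x where r: "strict_mono r" "limitin Y (a \<circ> r) x sequentially"
    using assms(3) by (auto simp: has_convergent_subsequence_def)
  then have "x \<in> K"
    by (rule_tac limitin_closedin[OF _ assms(1)]) (use assms(2) in auto)
  then show ?thesis
    using r assms(2) unfolding has_convergent_subsequence_def limitin_subtopology by auto
qed

text \<open>The dense witness is cut down to the interior of \<open>K\<close>, and accumulation
  points stay in the closed set \<open>K\<close>. So this positive property, like the two treated
  next, has to be proved only for the whole spaces.\<close>

lemma DRC_regular_closed:
  assumes "DRC Y" and K: "regular_closed_in Y K"
  shows "DRC (subtopology Y K)"
proof -
  obtain D where D: "dense_subset_of D Y" "relatively_countably_compact Y D"
    using assms(1) by (auto simp: DRC_def)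
  note dense = dense_subset_of_regular_closed[OF D(1) K]
  have "relatively_countably_compact (subtopology Y K) (D \<inter> Y interior_of K)"
    unfolding relatively_countably_compact_def
  proof (intro conjI allI impI)
    show "D \<inter> Y interior_of K \<subseteq> topspace (subtopology Y K)"
      using dense by (simp add: dense_subset_of_def)
    fix a :: "nat \<Rightarrow> _"
    assume a: "\<forall>n. a n \<in> D \<inter> Y interior_of K"
    then obtain x where x: "accumulation_point_of_seq Y a x"
      using D(2) unfolding relatively_countably_compact_def by blast
    have "a n \<in> K" for n
      using a interior_of_subset[of Y K] by blast
    then show "\<exists>x. accumulation_point_of_seq (subtopology Y K) a x"
      using accumulation_point_in_closed_subspace[OF regular_closed_in_closedin[OF K] _ x] by blast
  qed
  with dense show ?thesis
    unfolding DRC_def by blast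
qed

lemma DRC_omega_regular_closed:
  assumes "DRC_omega Y" and K: "regular_closed_in Y K"
  shows "DRC_omega (subtopology Y K)"
proof -
  obtain D :: "nat \<Rightarrow> _" where D: "\<And>n. dense_subset_of (D n) Y"
    "\<And>d. (\<And>n. d n \<in> D n) \<Longrightarrow> \<exists>x. accumulation_point_of_seq Y d x"
    using assms(1) unfolding DRC_omega_def by metis
  have "\<exists>x. accumulation_point_of_seq (subtopology Y K) d x"
    if d: "\<forall>n. d n \<in> D n \<inter> Y interior_of K" for d :: "nat \<Rightarrow> _"
  proof -
    have "d n \<in> K" for n
      using d interior_of_subset[of Y K] by blast
    moreover obtain x where "accumulation_point_of_seq Y d x"
      using D(2) d by blast
    ultimately show ?thesis
      using accumulation_point_in_closed_subspace[OF regular_closed_in_closedin[OF K]] by blast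
  qed
  then show ?thesis
    using dense_subset_of_regular_closed[OF D(1) K] unfolding DRC_omega_def
    by (intro exI[of _ "\<lambda>n. D n \<inter> Y interior_of K"]) auto
qed

lemma DRS_omega_regular_closed:
  assumes "DRS_omega Y" and K: "regular_closed_in Y K"
  shows "DRS_omega (subtopology Y K)"
proof -
  obtain D :: "nat \<Rightarrow> _" where D: "\<And>n. dense_subset_of (D n) Y"
    "\<And>d. (\<And>n. d n \<in> D n) \<Longrightarrow> has_convergent_subsequence Y d"
    using assms(1) unfolding DRS_omega_def by metis
  have "has_convergent_subsequence (subtopology Y K) d"
    if d: "\<forall>n. d n \<in> D n \<inter> Y interior_of K" for d :: "nat \<Rightarrow> _"
  proof (rule convergent_subsequence_in_closed_subspace[OF regular_closed_in_closedin[OF K]])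
    show "d n \<in> K" for n
      using d interior_of_subset[of Y K] by blast
    show "has_convergent_subsequence Y d"
      using D(2) d by blast
  qed
  then show ?thesis
    using dense_subset_of_regular_closed[OF D(1) K] unfolding DRS_omega_def
    by (intro exI[of _ "\<lambda>n. D n \<inter> Y interior_of K"]) auto
qed

text \<open>Finitely many earlier values can always be avoided. This serves to refute
  \<open>DRS_omega\<close> for arbitrary dense sets.\<close>

lemma inj_transversal_choice:
  assumes "\<And>n :: nat. infinite (D n)"
  obtains d :: "nat \<Rightarrow> _" where "inj d" "\<And>n. d n \<in> D n"
proof -
  have "\<exists>d. \<forall>n. d n \<in> D n - d ` {..<n}"
  proof (rule dependent_wellorder_choice)
    show "(r \<in> D n - f ` {..<n}) = (r \<in> D n - g ` {..<n})" if "\<And>m. m < n \<Longrightarrow> f m = g m" for f g n r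
      using that by (metis image_cong lessThan_iff)
    show "\<exists>r. r \<in> D n - f ` {..<n}" for f n
      using assms[of n] by (metis Diff_infinite_finite ex_in_conv finite.emptyI finite_imageI finite_lessThan)
  qed
  then obtain d where d: "\<And>n. d n \<in> D n - d ` {..<n}"
    by blast
  have "inj d"
  proof (rule linorder_injI)
    fix m n :: nat assume "m < n"
    then show "d m \<noteq> d n"
      using d[of n] by (metis Diff_iff imageI lessThan_iff)
  qed
  with d show thesis
    by (intro that) auto
qed

section \<open>The topology generated by the cylinders\<close>

context layered_system
begin

definition cyl :: "'b set \<Rightarrow> 'a \<Rightarrow> 'a set"
  where "cyl P x = {y. \<forall>b\<in>P. G b y = G b x}"

text \<open>The topology induced by the map sending \<open>x\<close> to its coordinates
  \<open>G \<beta> x\<close>, in the product of discrete spaces.\<close>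

definition cyl_topology :: "'a topology"
  where "cyl_topology = topology (\<lambda>U. \<forall>x\<in>U. \<exists>P. finite P \<and> cyl P x \<subseteq> U)"

definition layers :: "nat \<Rightarrow> 'a set"
  where "layers i = {x. fst (L x) = i}"

lemma self_in_cyl [simp]: "x \<in> cyl P x"
  by (simp add: cyl_def)

lemma cyl_subset: "y \<in> cyl P x \<Longrightarrow> P \<subseteq> P' \<Longrightarrow> cyl P' y \<subseteq> cyl P x"
  by (auto simp: cyl_def)

lemma openin_cyl_topology: "openin cyl_topology U \<longleftrightarrow> (\<forall>x\<in>U. \<exists>P. finite P \<and> cyl P x \<subseteq> U)"
proof -
  have "istopology (\<lambda>U. \<forall>x\<in>U. \<exists>P. finite P \<and> cyl P x \<subseteq> U)"
    unfolding istopology_def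
  proof (intro conjI allI impI ballI)
    fix U V x
    assume "\<forall>x\<in>U. \<exists>P. finite P \<and> cyl P x \<subseteq> U" "\<forall>x\<in>V. \<exists>P. finite P \<and> cyl P x \<subseteq> V" "x \<in> U \<inter> V"
    then obtain P P' where "finite P" "cyl P x \<subseteq> U" "finite P'" "cyl P' x \<subseteq> V"
      by blast
    then show "\<exists>P. finite P \<and> cyl P x \<subseteq> U \<inter> V"
      by (intro exI[of _ "P \<union> P'"]) (auto simp: cyl_def)
  next
    fix \<K> x
    assume "\<forall>K\<in>\<K>. \<forall>x\<in>K. \<exists>P. finite P \<and> cyl P x \<subseteq> K" "x \<in> \<Union>\<K>"
    then show "\<exists>P. finite P \<and> cyl P x \<subseteq> \<Union>\<K>"
      by (meson UnionE Union_upper order_trans)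
  qed
  then show ?thesis
    by (simp add: cyl_topology_def)
qed

lemma topspace_cyl_topology [simp]: "topspace cyl_topology = UNIV"
proof -
  have "openin cyl_topology UNIV"
    by (auto simp: openin_cyl_topology)
  then show ?thesis
    using openin_subset by blast
qed

lemma openin_cyl: "finite P \<Longrightarrow> openin cyl_topology (cyl P x)"
  unfolding openin_cyl_topology using cyl_subset by blast

lemma closedin_cyl: "finite P \<Longrightarrow> closedin cyl_topology (cyl P x)"
  unfolding closedin_def openin_cyl_topology by (auto simp: cyl_def intro!: exI[of _ P])

lemma level_meets_cyl:
  assumes "finite P"
  obtains y where "L y = l" "y \<in> cyl P x"
  using dense[OF countable_empty assms, of l x] by (auto simp: cyl_def)

lemma crowded: "crowded_space cyl_topology"
  unfolding crowded_space_def
proof (intro ballI notI)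
  fix x assume "openin cyl_topology {x}"
  then obtain P where P: "finite P" "cyl P x \<subseteq> {x}"
    unfolding openin_cyl_topology by blast
  obtain y \<beta> where "\<forall>b\<in>P. G b y = G b x" "G \<beta> x \<noteq> G \<beta> y"
    using dense[of "{x}" P undefined x] P(1) by auto
  then show False
    using P(2) by (auto simp: cyl_def)
qed

lemma zero_dimensional: "zero_dimensional_space cyl_topology"
  unfolding zero_dimensional_space_def
proof (intro exI[of _ "{cyl P x | P x. finite P}"] conjI allI impI)
  show "\<forall>V\<in>{cyl P x | P x. finite P}. openin cyl_topology V \<and> closedin cyl_topology V"
    by (auto simp: openin_cyl closedin_cyl)
  fix U x assume "openin cyl_topology U \<and> x \<in> U"
  then obtain P where "finite P" "cyl P x \<subseteq> U"
    unfolding openin_cyl_topology by blast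
  then show "\<exists>V\<in>{cyl P x | P x. finite P}. x \<in> V \<and> V \<subseteq> U"
    by (intro bexI[of _ "cyl P x"]) auto
qed

lemma Hausdorff: "Hausdorff_space cyl_topology"
  unfolding Hausdorff_space_def
proof (intro allI impI)
  fix x y assume "x \<in> topspace cyl_topology \<and> y \<in> topspace cyl_topology \<and> x \<noteq> y"
  then obtain \<beta> where "G \<beta> x \<noteq> G \<beta> y"
    using separated by blast
  then have "disjnt (cyl {\<beta>} x) (cyl {\<beta>} y)"
    by (auto simp: disjnt_def cyl_def)
  then show "\<exists>U V. openin cyl_topology U \<and> openin cyl_topology V \<and> x \<in> U \<and> y \<in> V \<and> disjnt U V"
    by (meson finite.intros openin_cyl self_in_cyl)
qed

lemma dense_layers: "dense_subset_of (layers i) cyl_topology"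
  unfolding dense_subset_of_iff
proof (intro conjI allI impI)
  fix U assume "openin cyl_topology U \<and> U \<noteq> {}"
  then obtain P x where "finite P" "cyl P x \<subseteq> U"
    unfolding openin_cyl_topology by blast
  moreover obtain y where "L y = (i, 0)" "y \<in> cyl P x"
    using level_meets_cyl[OF \<open>finite P\<close>] .
  ultimately show "layers i \<inter> U \<noteq> {}"
    by (force simp: layers_def)
qed simp

lemma dense_level: "dense_subset_of {z. L z = (i, m)} (subtopology cyl_topology (layers i))"
  unfolding dense_subset_of_iff
proof (intro conjI allI impI)
  fix U assume "openin (subtopology cyl_topology (layers i)) U \<and> U \<noteq> {}"
  then obtain V x where V: "openin cyl_topology V" "U = V \<inter> layers i" "x \<in> V"
    by (auto simp: openin_subtopology)
  then obtain P where "finite P" "cyl P x \<subseteq> V"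
    unfolding openin_cyl_topology by blast
  moreover obtain y where "L y = (i, m)" "y \<in> cyl P x"
    using level_meets_cyl[OF \<open>finite P\<close>] .
  ultimately show "{z. L z = (i, m)} \<inter> U \<noteq> {}"
    using V(2) by (force simp: layers_def)
qed (auto simp: layers_def)

lemma limitin_layersI:
  assumes "x \<in> layers i" and "\<And>n. a n \<in> layers i" and "\<And>\<beta>. \<forall>\<^sub>F n in sequentially. G \<beta> (a n) = G \<beta> x"
  shows "limitin (subtopology cyl_topology (layers i)) a x sequentially"
proof -
  have "\<forall>\<^sub>F n in sequentially. a n \<in> U" if U: "openin cyl_topology U" "x \<in> U" for U
  proof -
    obtain P where P: "finite P" "cyl P x \<subseteq> U"
      using U unfolding openin_cyl_topology by blast
    have "\<forall>\<^sub>F n in sequentially. \<forall>\<beta>\<in>P. G \<beta> (a n) = G \<beta> x"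
      using P(1) assms(3) by (intro eventually_ball_finite) auto
    then show ?thesis
      by (rule eventually_mono) (use P(2) in \<open>auto simp: cyl_def\<close>)
  qed
  then have "limitin cyl_topology a x sequentially"
    by (simp add: limitin_def)
  then show ?thesis
    using assms(1,2) by (simp add: limitin_subtopology)
qed

lemma accumulation_point_layersI:
  assumes "x \<in> layers i" and "\<And>n. a n \<in> layers i" and "\<And>P. finite P \<Longrightarrow> infinite {n. a n \<in> cyl P x}"
  shows "accumulation_point_of_seq (subtopology cyl_topology (layers i)) a x"
  unfolding accumulation_point_of_seq_def
proof (intro conjI allI impI)
  fix U assume "openin (subtopology cyl_topology (layers i)) U \<and> x \<in> U"
  then obtain P where "finite P" "cyl P x \<inter> layers i \<subseteq> U"
    unfolding openin_subtopology openin_cyl_topology by blast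
  then have "{n. a n \<in> cyl P x} \<subseteq> {n. a n \<in> U}"
    using assms(2) by blast
  then show "infinite {n. a n \<in> U}"
    using assms(3)[OF \<open>finite P\<close>] infinite_super by blast
qed (use assms(1) in simp)

lemma accumulation_point_layersD:
  assumes "accumulation_point_of_seq (subtopology (subtopology cyl_topology Z) K) a x" and "finite P"
  shows "infinite {n. a n \<in> cyl P x}"
proof -
  have "openin (subtopology cyl_topology (Z \<inter> K)) (cyl P x \<inter> (Z \<inter> K))"
    using openin_cyl[OF assms(2)] by (rule openin_subtopology_Int)
  moreover have "x \<in> cyl P x \<inter> (Z \<inter> K)"
    using assms(1) by (simp add: accumulation_point_of_seq_def)
  ultimately have "infinite {n. a n \<in> cyl P x \<inter> (Z \<inter> K)}"
    using assms(1) unfolding accumulation_point_of_seq_def subtopology_subtopology by blast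
  then show ?thesis
    by (rule infinite_super[rotated]) auto
qed

lemma convergent_subsequenceD:
  assumes "has_convergent_subsequence (subtopology (subtopology cyl_topology Z) K) d"
  obtains r :: "nat \<Rightarrow> nat" and x where "strict_mono r" "\<And>\<beta>. \<forall>\<^sub>F n in sequentially. G \<beta> ((d \<circ> r) n) = G \<beta> x"
proof -
  obtain r x where r: "strict_mono r" "limitin cyl_topology (d \<circ> r) x sequentially"
    using assms by (auto simp: has_convergent_subsequence_def limitin_subtopology)
  have "\<forall>\<^sub>F n in sequentially. (d \<circ> r) n \<in> cyl {\<beta>} x" for \<beta>
    using r(2) openin_cyl[of "{\<beta>}" x] unfolding limitin_def by simp
  then show thesis
    by (intro that[OF r(1), of x]) (simp add: cyl_def)
qed

section \<open>Positive compactness properties of the three subspaces\<close>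

lemma transversal_sequence:
  assumes "\<And>n. L (d n) = (i, n)"
  shows "inj d" and "transversal L i (range d)"
proof -
  show "inj d"
    using assms by (metis injI prod.inject)
  moreover have "finite {z \<in> range d. L z = (i, m)}" for m
    by (rule finite_subset[of _ "{d m}"]) (auto simp: assms)
  ultimately show "transversal L i (range d)"
    using assms by (auto simp: transversal_def range_inj_infinite)
qed

text \<open>With the levels as dense sets, every selection is injective and has a transversal range,
  so it contains an infinite set converging coordinatewise.\<close>

lemma DRS_omega_layers:
  assumes "i < 2"
  shows "DRS_omega (subtopology cyl_topology (layers i))"
  unfolding DRS_omega_def
proof (intro exI[of _ "\<lambda>n. {z. L z = (i, n)}"] conjI allI impI)
  fix d :: "nat \<Rightarrow> 'a"
  assume "\<forall>n. d n \<in> {z. L z = (i, n)}"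
  then have d: "L (d n) = (i, n)" for n
    by simp
  note tr = transversal_sequence[OF d]
  obtain T y where T: "T \<subseteq> range d" "infinite T" "fst (L y) = i" "\<And>\<beta>. finite {z \<in> T. G \<beta> z \<noteq> G \<beta> y}"
    using convergent[OF tr(2) assms] by blast
  define N where "N = {n. d n \<in> T}"
  have "T = d ` N"
    using T(1) by (auto simp: N_def)
  then have N: "infinite N"
    using T(2) by auto
  \<comment> \<open>The increasing enumeration of the indices turns the convergent set into a
    subsequence; injectivity turns finitely many exceptional points into finitely many
    indices.\<close>
  define r where "r = enumerate N"
  have r: "strict_mono r" "\<And>k. d (r k) \<in> T"
    using N enumerate_in_set[OF N] by (auto simp: r_def N_def strict_mono_enumerate)
  have inj: "inj (d \<circ> r)"
    using tr(1) strict_mono_imp_inj_on[OF r(1)] by (simp add: inj_compose)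
  have "limitin (subtopology cyl_topology (layers i)) (d \<circ> r) y sequentially"
  proof (rule limitin_layersI)
    fix \<beta>
    have "(d \<circ> r) ` {k. G \<beta> ((d \<circ> r) k) \<noteq> G \<beta> y} \<subseteq> {z \<in> T. G \<beta> z \<noteq> G \<beta> y}"
      using r(2) by auto
    then have "finite {k. G \<beta> ((d \<circ> r) k) \<noteq> G \<beta> y}"
      using T(4)[of \<beta>] finite_imageD[OF finite_subset] inj_on_subset[OF inj subset_UNIV] by blast
    then show "\<forall>\<^sub>F k in sequentially. G \<beta> ((d \<circ> r) k) = G \<beta> y"
      by (simp add: cofinite_eq_sequentially[symmetric] eventually_cofinite)
  qed (use T(3) d in \<open>auto simp: layers_def\<close>)
  then show "has_convergent_subsequence (subtopology cyl_topology (layers i)) d"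
    using r(1) unfolding has_convergent_subsequence_def by blast
qed (rule dense_level)

lemma clustering_accumulation_point:
  assumes "clustering L i (range d)"
  shows "\<exists>x. accumulation_point_of_seq (subtopology cyl_topology (layers i)) d x"
proof -
  obtain y where y: "fst (L y) = i" "\<And>P. finite P \<Longrightarrow> infinite {z \<in> range d. \<forall>b\<in>P. G b z = G b y}"
    using cluster[OF assms] by blast
  have "accumulation_point_of_seq (subtopology cyl_topology (layers i)) d y"
  proof (rule accumulation_point_layersI)
    show "d n \<in> layers i" for n
      using assms by (auto simp: clustering_def on_level_def transversal_def layers_def)
    fix P :: "'b set" assume P: "finite P"
    have "{z \<in> range d. \<forall>b\<in>P. G b z = G b y} \<subseteq> d ` {n. d n \<in> cyl P y}"
      by (auto simp: cyl_def)
    then show "infinite {n. d n \<in> cyl P y}"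
      using y(2)[OF P] finite_subset by blast
  qed (use y(1) in \<open>simp add: layers_def\<close>)
  then show ?thesis ..
qed

lemma DRC_omega_layers: "DRC_omega (subtopology cyl_topology (layers 2))"
  unfolding DRC_omega_def
proof (intro exI[of _ "\<lambda>n. {z. L z = (2, n)}"] conjI allI impI)
  fix d :: "nat \<Rightarrow> 'a"
  assume "\<forall>n. d n \<in> {z. L z = (2, n)}"
  then have "transversal L 2 (range d)"
    by (intro transversal_sequence) simp
  then show "\<exists>x. accumulation_point_of_seq (subtopology cyl_topology (layers 2)) d x"
    by (intro clustering_accumulation_point) (simp add: clustering_def)
qed (rule dense_level)

text \<open>The dense set is a single level. There a sequence with infinite range has a clustering
  range, and one with finite range repeats a value infinitely often.\<close>

lemma DRC_layers: "DRC (subtopology cyl_topology (layers 1))"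
  unfolding DRC_def relatively_countably_compact_def
proof (intro exI[of _ "{z. L z = (1, 0)}"] conjI allI impI)
  fix a :: "nat \<Rightarrow> 'a"
  assume "\<forall>n. a n \<in> {z. L z = (1, 0)}"
  then have a: "L (a n) = (1, 0)" for n
    by simp
  show "\<exists>x. accumulation_point_of_seq (subtopology cyl_topology (layers 1)) a x"
  proof (cases "finite (range a)")
    case True
    then obtain k where k: "infinite {n. a n = a k}"
      using pigeonhole_infinite[OF infinite_UNIV_nat True] by auto
    have "accumulation_point_of_seq (subtopology cyl_topology (layers 1)) a (a k)"
    proof (rule accumulation_point_layersI)
      show "infinite {n. a n \<in> cyl P (a k)}" for P
        by (rule infinite_super[OF _ k]) (auto simp: cyl_def)
    qed (simp_all add: layers_def a)
    then show ?thesis ..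
  next
    case False
    then have "clustering L 1 (range a)"
      using a by (auto simp: clustering_def on_level_def)
    then show ?thesis
      by (rule clustering_accumulation_point)
  qed
qed (use dense_level in \<open>auto simp: layers_def\<close>)

section \<open>Failure of the compactness properties in regular closed sets\<close>

context
  fixes i K
  assumes K: "regular_closed_in (subtopology cyl_topology (layers i)) K" and nonempty: "K \<noteq> {}"
begin

text \<open>For countable \<open>D\<close> there is a point \<open>y\<close> in the interior of
  \<open>K\<close> with a coordinate at which it differs from every point of \<open>D\<close>. The
  cylinder of \<open>y\<close> at this coordinate is a neighbourhood missing
  \<open>D\<close>.\<close>

lemma dense_uncountable:
  assumes D: "dense_subset_of D (subtopology (subtopology cyl_topology (layers i)) K)"
  shows "uncountable D"
proof
  let ?Y = "subtopology cyl_topology (layers i)"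
  let ?V = "?Y interior_of K"
  assume cD: "countable D"
  have "?V \<noteq> {}"
    using K nonempty by (auto simp: regular_closed_in_def)
  then obtain x where "x \<in> ?V"
    by blast
  moreover have "openin ?Y ?V"
    by simp
  ultimately obtain P where P: "finite P" "cyl P x \<inter> layers i \<subseteq> ?V"
    unfolding openin_subtopology openin_cyl_topology by blast
  obtain y \<beta> where y: "L y = (i, 0)" "\<forall>b\<in>P. G b y = G b x" "\<forall>z\<in>D. G \<beta> z \<noteq> G \<beta> y"
    using dense[OF cD P(1)] by meson
  let ?W = "cyl (insert \<beta> P) y \<inter> layers i"
  have "?W \<subseteq> cyl P x \<inter> layers i"
    using y(2) by (auto simp: cyl_def)
  then have "?W \<subseteq> K"
    using P(2) interior_of_subset[of ?Y K] by blast
  moreover have "openin ?Y ?W"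
    using openin_cyl[of "insert \<beta> P" y] P(1) by (intro openin_subtopology_Int) simp
  ultimately have "openin (subtopology ?Y K) ?W"
    by (metis inf.absorb_iff2 inf_commute openin_subtopology_Int)
  moreover have "y \<in> ?W"
    using y(1) by (simp add: layers_def)
  ultimately have "D \<inter> ?W \<noteq> {}"
    using D unfolding dense_subset_of_iff by blast
  then show False
    using y(3) by (auto simp: cyl_def)
qed

text \<open>An uncountable set cannot meet each of the countably many levels in a finite
  set.\<close>

lemma dense_contains_sequence_on_level:
  assumes D: "dense_subset_of D (subtopology (subtopology cyl_topology (layers i)) K)"
  shows "\<exists>(d :: nat \<Rightarrow> 'a) m. inj d \<and> (\<forall>n. d n \<in> D \<and> L (d n) = (i, m))"
proof -
  have "D \<subseteq> layers i"
    using D by (auto simp: dense_subset_of_def)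
  then have D_eq: "D = (\<Union>m. {z \<in> D. L z = (i, m)})"
    by (auto simp: layers_def prod_eq_iff)
  have "\<not> (\<forall>m. finite {z \<in> D. L z = (i, m)})"
  proof
    assume "\<forall>m. finite {z \<in> D. L z = (i, m)}"
    then have "countable (\<Union>m. {z \<in> D. L z = (i, m)})"
      by (intro countable_UN) (auto intro: countable_finite)
    then show False
      using dense_uncountable[OF D] D_eq by simp
  qed
  then obtain m where "infinite {z \<in> D. L z = (i, m)}"
    by blast
  then obtain d :: "nat \<Rightarrow> 'a" where "inj d" "range d \<subseteq> {z \<in> D. L z = (i, m)}"
    using infinite_countable_subset by blast
  then show ?thesis
    by blast
qed

text \<open>An injective sequence on one level has no accumulation point: one coordinate tells
  \<open>x\<close> from all other terms, and \<open>x\<close> itself occurs at most once.\<close>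

lemma not_DRC_layers:
  assumes "i = 0 \<or> i = 2"
  shows "\<not> DRC (subtopology (subtopology cyl_topology (layers i)) K)"
proof
  assume "DRC (subtopology (subtopology cyl_topology (layers i)) K)"
  then obtain D where D: "dense_subset_of D (subtopology (subtopology cyl_topology (layers i)) K)"
    "relatively_countably_compact (subtopology (subtopology cyl_topology (layers i)) K) D"
    by (auto simp: DRC_def)
  obtain d :: "nat \<Rightarrow> 'a" and m where d: "inj d" "\<And>n. d n \<in> D" "\<And>n. L (d n) = (i, m)"
    using dense_contains_sequence_on_level[OF D(1)] by blast
  obtain x where x: "accumulation_point_of_seq (subtopology (subtopology cyl_topology (layers i)) K) d x"
    using D(2) d(2) unfolding relatively_countably_compact_def by blast
  have "on_level L i (range d)"
    using d by (auto simp: on_level_def range_inj_infinite)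
  then obtain \<beta> where \<beta>: "\<forall>z\<in>range d - {x}. G \<beta> z \<noteq> G \<beta> x"
    using discrete[OF _ assms] by blast
  have "{n. d n \<in> cyl {\<beta>} x} \<subseteq> {n. d n = x}"
    using \<beta> by (auto simp: cyl_def)
  moreover have "finite {n. d n = x}"
    using finite_vimageI[OF _ d(1), of "{x}"] by (simp add: vimage_def)
  ultimately show False
    using accumulation_point_layersD[OF x, of "{\<beta>}"] finite_subset by blast
qed

end

lemma clustering_not_convergent:
  assumes "clustering L i (range a)"
  shows "\<exists>\<beta>. \<not> (\<forall>\<^sub>F n in sequentially. G \<beta> (a n) = G \<beta> x)"
proof -
  obtain \<beta> v w where vw: "v \<noteq> w" "infinite {z \<in> range a. G \<beta> z = v}" "infinite {z \<in> range a. G \<beta> z = w}"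
    using divergent[OF assms] by blast
  \<comment> \<open>Of two distinct values at least one differs from the value at the supposed
    limit.\<close>
  then obtain u where u: "u \<noteq> G \<beta> x" "infinite {z \<in> range a. G \<beta> z = u}"
    by metis
  have "\<not> (\<forall>\<^sub>F n in sequentially. G \<beta> (a n) = G \<beta> x)"
  proof
    assume "\<forall>\<^sub>F n in sequentially. G \<beta> (a n) = G \<beta> x"
    then have "finite {n. G \<beta> (a n) \<noteq> G \<beta> x}"
      by (simp add: cofinite_eq_sequentially[symmetric] eventually_cofinite)
    moreover have "{z \<in> range a. G \<beta> z = u} \<subseteq> a ` {n. G \<beta> (a n) \<noteq> G \<beta> x}"
      using u(1) by auto
    ultimately show False
      using u(2) finite_subset by blast
  qed
  then show ?thesis ..
qed

text \<open>Each subsequence of an injective sequence on one level again has a clustering range, so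
  it diverges.\<close>

lemma not_DRS_layers:
  assumes "regular_closed_in (subtopology cyl_topology (layers 1)) K" and "K \<noteq> {}"
  shows "\<not> DRS (subtopology (subtopology cyl_topology (layers 1)) K)"
proof
  assume "DRS (subtopology (subtopology cyl_topology (layers 1)) K)"
  then obtain D where D: "dense_subset_of D (subtopology (subtopology cyl_topology (layers 1)) K)"
    "relatively_sequentially_compact (subtopology (subtopology cyl_topology (layers 1)) K) D"
    by (auto simp: DRS_def)
  obtain d :: "nat \<Rightarrow> 'a" and m where d: "inj d" "\<And>n. d n \<in> D" "\<And>n. L (d n) = (1, m)"
    using dense_contains_sequence_on_level[OF assms D(1)] by blast
  have "has_convergent_subsequence (subtopology (subtopology cyl_topology (layers 1)) K) d"
    using D(2) d(2) unfolding relatively_sequentially_compact_def by blast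
  then obtain r x where r: "strict_mono r" "\<And>\<beta>. \<forall>\<^sub>F n in sequentially. G \<beta> ((d \<circ> r) n) = G \<beta> x"
    using convergent_subsequenceD by blast
  have "inj (d \<circ> r)"
    using d(1) strict_mono_imp_inj_on[OF r(1)] by (simp add: inj_compose)
  then have "infinite (range (d \<circ> r))"
    by (rule range_inj_infinite)
  then have "clustering L 1 (range (d \<circ> r))"
    using d(3) by (auto simp: clustering_def on_level_def)
  then show False
    using clustering_not_convergent r(2) by blast
qed

text \<open>The dense sets are arbitrary, so the levels of the selected points are not under
  control. But convergence itself forces a transversal range, as an infinite part on one level would
  be closed and discrete; and then the range is clustering, which excludes convergence.\<close>

lemma not_DRS_omega_layers:
  assumes "regular_closed_in (subtopology cyl_topology (layers 2)) K" and "K \<noteq> {}"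
  shows "\<not> DRS_omega (subtopology (subtopology cyl_topology (layers 2)) K)"
proof
  assume "DRS_omega (subtopology (subtopology cyl_topology (layers 2)) K)"
  then obtain D :: "nat \<Rightarrow> 'a set" where D: "\<And>n. dense_subset_of (D n) (subtopology (subtopology cyl_topology (layers 2)) K)"
    "\<And>d. (\<And>n. d n \<in> D n) \<Longrightarrow> has_convergent_subsequence (subtopology (subtopology cyl_topology (layers 2)) K) d"
    unfolding DRS_omega_def by metis
  have "infinite (D n)" for n
    using dense_uncountable[OF assms D(1)] countable_finite by blast
  then obtain d where d: "inj d" "\<And>n. d n \<in> D n"
    using inj_transversal_choice by metis
  then obtain r x where r: "strict_mono r" "\<And>\<beta>. \<forall>\<^sub>F n in sequentially. G \<beta> ((d \<circ> r) n) = G \<beta> x"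
    using convergent_subsequenceD D(2) by blast
  define a where "a = d \<circ> r"
  have a: "inj a" "\<And>\<beta>. finite {n. G \<beta> (a n) \<noteq> G \<beta> x}"
    using d(1) strict_mono_imp_inj_on[OF r(1)] r(2)
    by (simp_all add: a_def inj_compose cofinite_eq_sequentially[symmetric] eventually_cofinite)
  have "a n \<in> layers 2" for n
    using D(1)[of "r n"] d(2)[of "r n"] by (auto simp: dense_subset_of_def a_def)
  then have tag: "fst (L (a n)) = 2" for n
    by (simp add: layers_def)
  have "finite {z \<in> range a. L z = (2, m)}" for m
  proof (rule ccontr)
    assume inf: "infinite {z \<in> range a. L z = (2, m)}"
    then have "on_level L 2 {z \<in> range a. L z = (2, m)}"
      by (auto simp: on_level_def)
    then obtain \<beta> where \<beta>: "\<forall>z\<in>{z \<in> range a. L z = (2, m)} - {x}. G \<beta> z \<noteq> G \<beta> x"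
      using discrete by blast
    have "{z \<in> range a. L z = (2, m)} \<subseteq> insert x (a ` {n. G \<beta> (a n) \<noteq> G \<beta> x})"
      using \<beta> by auto
    then show False
      using inf a(2)[of \<beta>] by (meson finite_imageI finite_insert finite_subset)
  qed
  then have "clustering L 2 (range a)"
    using a(1) tag by (auto simp: clustering_def transversal_def range_inj_infinite)
  then show False
    using clustering_not_convergent r(2) unfolding a_def by blast
qed

end

theorem theorem1p3:
  assumes "Continuum_Hypothesis"
  shows "\<exists>(X :: nat set topology) Z\<^sub>1 Z\<^sub>2 Z\<^sub>3.
    crowded_space X \<and> zero_dimensional_space X \<and> Hausdorff_space X \<and>
    has_cardinality_omega1 (topspace X) \<and>
    dense_subset_of Z\<^sub>1 X \<and> dense_subset_of Z\<^sub>2 X \<and> dense_subset_of Z\<^sub>3 X \<and>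
    (\<forall>K. regular_closed_in (subtopology X Z\<^sub>1) K \<and> K \<noteq> {} \<longrightarrow>
      (let Y = subtopology (subtopology X Z\<^sub>1) K in
        DRS_omega Y \<and> \<not> DRC Y)) \<and>
    (\<forall>K. regular_closed_in (subtopology X Z\<^sub>2) K \<and> K \<noteq> {} \<longrightarrow>
      (let Y = subtopology (subtopology X Z\<^sub>2) K in
        DRS_omega Y \<and> DRC Y \<and> \<not> DRS Y)) \<and>
    (\<forall>K. regular_closed_in (subtopology X Z\<^sub>3) K \<and> K \<noteq> {} \<longrightarrow>
      (let Y = subtopology (subtopology X Z\<^sub>3) K in
        DRC_omega Y \<and> \<not> DRC Y \<and> \<not> DRS_omega Y))"
proof -
  obtain \<iota> :: "omega1 \<Rightarrow> nat set" where \<iota>: "bij \<iota>"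
    using bij_omega1_nat_set_CH[OF assms] .
  obtain G :: "omega1 \<Rightarrow> omega1 \<Rightarrow> nat" and L where "layered_system G L"
    using layered_system_omega1[OF assms] by blast
  \<comment> \<open>The points are renamed along the bijection provided by the continuum hypothesis,
    because the space is to live on sets of natural numbers.\<close>
  then interpret layered_system "\<lambda>\<beta> a. G \<beta> (inv \<iota> a)" "\<lambda>a. L (inv \<iota> a)"
    by (rule layered_system_bij) (rule bij_imp_bij_inv[OF \<iota>])
  show ?thesis
  proof (rule exI[of _ cyl_topology], rule exI[of _ "layers 0"], rule exI[of _ "layers 1"],
      rule exI[of _ "layers 2"], unfold Let_def, intro conjI allI impI; (elim conjE)?)
    show "has_cardinality_omega1 (topspace cyl_topology)"
      using card_nat_set_CH[OF assms] by (simp add: has_cardinality_omega1_def)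
  qed (simp_all add: crowded zero_dimensional Hausdorff dense_layers DRS_omega_regular_closed
      DRS_omega_layers DRC_regular_closed DRC_layers DRC_omega_regular_closed DRC_omega_layers
      not_DRC_layers not_DRS_layers not_DRS_omega_layers del: One_nat_def)
qed

end
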